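(* Let $Q$ be a quiver, $\kappa\geq\max\{\mathrm{rccn}(Q),\mathrm{ltccn}(Q)\}$ an infinite cardinal and $\mathcal{C}$ an $AB3(\kappa)$ abelian category. Then: (a) Let $F\in\mathrm{Rep}(Q,\mathcal{C})$ and let $\mathcal{U}$ be a generating class of $\mathcal{C}$. Then there are a family $\{U_i\}_{i\in\mathrm{Supp}(F)}$ of objects in $\mathcal{U}$ and an epimorphism $\coprod_{i\in\mathrm{Supp}(F)}f_i(U_i)\to F$ in $\mathrm{Rep}(Q,\mathcal{C})$. In particular, $\coprod_{\leq|Q_0|}f_*(\mathcal{U})$ is a generating class for $\mathrm{Rep}(Q,\mathcal{C})$. (b) If $\mathcal{C}$ has enough projectives, then $\mathrm{Rep}(Q,\mathcal{C})$ has enough projectives and $\mathrm{Add}_{\leq|Q_0|}(f_*(\mathrm{Proj}(\mathcal{C})))=\mathrm{Proj}(\mathrm{Rep}(Q,\mathcal{C}))$. (c) In general, $\mathrm{Add}_{\leq|Q_0|}(f_*(\mathrm{Proj}(\mathcal{C})))\subseteq\mathrm{Proj}(\mathrm{Rep}(Q,\mathcal{C}))\subseteq\mathrm{Add}_{\leq|Q_0|}(f_*(\mathcal{C}))$. (d) If $\mathcal{C}$ is $AB3^{*}(\kappa')$, where $\kappa'\geq\mathrm{lccn}(Q)$ is an infinite cardinal, and $g_i$ is exact for all $i\in Q_0$, then $\mathrm{Proj}(\mathrm{Rep}(Q,\mathcal{C}))=\mathrm{Add}_{\leq|Q_0|}(f_*(\mathrm{Proj}(\mathcal{C})))$.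
   Context: A quiver $Q$ consists of (possibly infinite) sets $Q_0$ of vertices and $Q_1$ of arrows with source and target maps. $Q(i,j)$ is the set of paths from $i$ to $j$ (including the trivial path if $i=j$), $Q(-,j)=\bigcup_iQ(i,j)$. $\mathrm{Rep}(Q,\mathcal{C})$ is the abelian category of $\mathcal{C}$-valued representations of $Q$; $\mathrm{Supp}(F)=\{i\in Q_0: F_i\neq0\}$. For a set $X$ of cardinals, $\mathrm{size}(X):=\sup X$ if $x<\sup X$ for all $x\in X$, and $\mathrm{size}(X):=(\sup X)^+$ otherwise. $\mathrm{rccn}(Q):=\sup_{i}\mathrm{size}(\{|Q(i,j)|\}_{j\in Q_0})$, $\mathrm{lccn}(Q):=\sup_{i}\mathrm{size}(\{|Q(j,i)|\}_{j\in Q_0})$, $\mathrm{ltccn}(Q):=\mathrm{size}(\{|Q(-,i)|\}_{i\in Q_0})$. An abelian category is $AB3(\kappa)$ (resp. $AB3^*(\kappa)$) if it has coproducts (resp. products) of families indexed by sets of cardinality $<\kappa$. $f_i:\mathcal{C}\to\mathrm{Rep}(Q,\mathcal{C})$: $(f_i(C))_j:=C^{(Q(i,j))}$ with inclusions $\mu_\rho^C$, and $(f_i(C))_\alpha\circ\mu^C_\rho=\mu^C_{\alpha\rho}$ for arrows $\alpha:k\to l$ and $\rho\in Q(i,k)$. $g_i:\mathcal{C}\to\mathrm{Rep}(Q,\mathcal{C})$: $(g_i(C))_j:=C^{Q(j,i)}$ with projections $\pi_\rho^C$, and $\pi^C_\rho\circ(g_i(C))_\alpha=\pi^C_{\rho\alpha}$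 for $\alpha:k\to l$, $\rho\in Q(l,i)$. For a class $\mathcal{S}\subseteq\mathcal{C}$, $f_*(\mathcal{S}):=\{f_i(S): i\in Q_0, S\in\mathcal{S}\}$. A class $\mathcal{U}$ of objects is generating if every object is a quotient of an object of $\mathcal{U}$. $\mathrm{Proj}$ denotes the class of projective objects. For a class $\mathcal{X}$ of objects and a cardinal $\lambda$, $\coprod_{\leq\lambda}\mathcal{X}$ is the class of all (existing) coproducts of families of objects of $\mathcal{X}$ indexed by sets of cardinality $\leq\lambda$, and $\mathrm{Add}_{\leq\lambda}(\mathcal{X})$ is the class of all direct summands of objects in $\coprod_{\leq\lambda}\mathcal{X}$. *)

theory Defs
  imports "HOL-Algebra.Group"
begin

unbundle cardinal_syntax

section \<open>Abelian categories\<close>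

text \<open>Categories carry the abelian group structure on their hom-sets (\<open>Plus\<close> and \<open>Zero\<close>).
  As in set-based mathematics with a universe, a class of objects is a set in a type.\<close>

record ('o, 'm) cat =
  Obj :: "'o set"
  Arr :: "'m set"
  Dom :: "'m \<Rightarrow> 'o"
  Cod :: "'m \<Rightarrow> 'o"
  Id :: "'o \<Rightarrow> 'm"
  Comp :: "'m \<Rightarrow> 'm \<Rightarrow> 'm"  (infixr "\<cdot>\<index>" 70)
  Plus :: "'m \<Rightarrow> 'm \<Rightarrow> 'm"
  Zero :: "'o \<Rightarrow> 'o \<Rightarrow> 'm"

definition Hom :: "('o, 'm) cat \<Rightarrow> 'o \<Rightarrow> 'o \<Rightarrow> 'm set" where
  "Hom C X Y = {f \<in> Arr C. Dom C f = X \<and> Cod C f = Y}"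

locale category =
  fixes C :: "('o, 'm) cat" (structure)
  assumes Dom_Obj: "f \<in> Arr C \<Longrightarrow> Dom C f \<in> Obj C"
    and Cod_Obj: "f \<in> Arr C \<Longrightarrow> Cod C f \<in> Obj C"
    and Id_Hom: "X \<in> Obj C \<Longrightarrow> Id C X \<in> Hom C X X"
    and Comp_Hom: "\<lbrakk>f \<in> Hom C X Y; g \<in> Hom C Y Z\<rbrakk> \<Longrightarrow> g \<cdot> f \<in> Hom C X Z"
    and Comp_assoc: "\<lbrakk>f \<in> Hom C W X; g \<in> Hom C X Y; h \<in> Hom C Y Z\<rbrakk> \<Longrightarrow> (h \<cdot> g) \<cdot> f = h \<cdot> (g \<cdot> f)"
    and Comp_Id_right: "f \<in> Hom C X Y \<Longrightarrow> f \<cdot> Id C X = f"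
    and Comp_Id_left: "f \<in> Hom C X Y \<Longrightarrow> Id C Y \<cdot> f = f"

definition hom_group :: "('o, 'm) cat \<Rightarrow> 'o \<Rightarrow> 'o \<Rightarrow> 'm monoid" where
  "hom_group C X Y = \<lparr>carrier = Hom C X Y, mult = Plus C, one = Zero C X Y\<rparr>"

locale preadditive_category = category +
  assumes hom_group: "\<lbrakk>X \<in> Obj C; Y \<in> Obj C\<rbrakk> \<Longrightarrow> comm_group (hom_group C X Y)"
    and Comp_Plus_right: "\<lbrakk>f \<in> Hom C X Y; f' \<in> Hom C X Y; g \<in> Hom C Y Z\<rbrakk>
      \<Longrightarrow> g \<cdot> Plus C f f' = Plus C (g \<cdot> f) (g \<cdot> f')"
    and Comp_Plus_left: "\<lbrakk>f \<in> Hom C X Y; g \<in> Hom C Y Z; g' \<in> Hom C Y Z\<rbrakk>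
      \<Longrightarrow> Plus C g g' \<cdot> f = Plus C (g \<cdot> f) (g' \<cdot> f)"

definition zero_obj :: "('o, 'm) cat \<Rightarrow> 'o \<Rightarrow> bool" where
  "zero_obj C Z \<longleftrightarrow> Z \<in> Obj C \<and>
     (\<forall>X \<in> Obj C. (\<exists>!f. f \<in> Hom C X Z) \<and> (\<exists>!f. f \<in> Hom C Z X))"

definition mono_arr :: "('o, 'm) cat \<Rightarrow> 'm \<Rightarrow> bool" where
  "mono_arr C f \<longleftrightarrow> f \<in> Arr C \<and>
     (\<forall>X. \<forall>u \<in> Hom C X (Dom C f). \<forall>v \<in> Hom C X (Dom C f).
        f \<cdot>\<^bsub>C\<^esub> u = f \<cdot>\<^bsub>C\<^esub> v \<longrightarrow> u = v)"

definition epi_arr :: "('o, 'm) cat \<Rightarrow> 'm \<Rightarrow> bool" where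
  "epi_arr C f \<longleftrightarrow> f \<in> Arr C \<and>
     (\<forall>X. \<forall>u \<in> Hom C (Cod C f) X. \<forall>v \<in> Hom C (Cod C f) X.
        u \<cdot>\<^bsub>C\<^esub> f = v \<cdot>\<^bsub>C\<^esub> f \<longrightarrow> u = v)"

definition is_kernel :: "('o, 'm) cat \<Rightarrow> 'm \<Rightarrow> 'm \<Rightarrow> bool" where
  "is_kernel C f k \<longleftrightarrow> f \<in> Arr C \<and> k \<in> Arr C \<and> Cod C k = Dom C f \<and>
     f \<cdot>\<^bsub>C\<^esub> k = Zero C (Dom C k) (Cod C f) \<and>
     (\<forall>X. \<forall>h \<in> Hom C X (Dom C f). f \<cdot>\<^bsub>C\<^esub> h = Zero C X (Cod C f) \<longrightarrow>
        (\<exists>!u. u \<in> Hom C X (Dom C k) \<and> k \<cdot>\<^bsub>C\<^esub> u = h))"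

definition is_cokernel :: "('o, 'm) cat \<Rightarrow> 'm \<Rightarrow> 'm \<Rightarrow> bool" where
  "is_cokernel C f q \<longleftrightarrow> f \<in> Arr C \<and> q \<in> Arr C \<and> Dom C q = Cod C f \<and>
     q \<cdot>\<^bsub>C\<^esub> f = Zero C (Dom C f) (Cod C q) \<and>
     (\<forall>X. \<forall>h \<in> Hom C (Cod C f) X. h \<cdot>\<^bsub>C\<^esub> f = Zero C (Dom C f) X \<longrightarrow>
        (\<exists>!u. u \<in> Hom C (Cod C q) X \<and> u \<cdot>\<^bsub>C\<^esub> q = h))"

definition is_biproduct ::
  "('o, 'm) cat \<Rightarrow> 'o \<Rightarrow> 'o \<Rightarrow> 'o \<Rightarrow> 'm \<Rightarrow> 'm \<Rightarrow> 'm \<Rightarrow> 'm \<Rightarrow> bool" where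
  "is_biproduct C X Y B i j p q \<longleftrightarrow>
     X \<in> Obj C \<and> Y \<in> Obj C \<and> B \<in> Obj C \<and>
     i \<in> Hom C X B \<and> j \<in> Hom C Y B \<and> p \<in> Hom C B X \<and> q \<in> Hom C B Y \<and>
     p \<cdot>\<^bsub>C\<^esub> i = Id C X \<and> q \<cdot>\<^bsub>C\<^esub> j = Id C Y \<and>
     q \<cdot>\<^bsub>C\<^esub> i = Zero C X Y \<and> p \<cdot>\<^bsub>C\<^esub> j = Zero C Y X \<and>
     Plus C (i \<cdot>\<^bsub>C\<^esub> p) (j \<cdot>\<^bsub>C\<^esub> q) = Id C B"

locale abelian_category = preadditive_category +
  assumes ex_zero_obj: "\<exists>Z. zero_obj C Z"
    and ex_biproduct: "\<lbrakk>X \<in> Obj C; Y \<in> Obj C\<rbrakk> \<Longrightarrow> \<exists>B i j p q. is_biproduct C X Y B i j p q"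
    and ex_kernel: "f \<in> Arr C \<Longrightarrow> \<exists>k. is_kernel C f k"
    and ex_cokernel: "f \<in> Arr C \<Longrightarrow> \<exists>q. is_cokernel C f q"
    and mono_is_kernel: "mono_arr C f \<Longrightarrow> \<exists>g. is_kernel C g f"
    and epi_is_cokernel: "epi_arr C f \<Longrightarrow> \<exists>g. is_cokernel C g f"

definition short_exact :: "('o, 'm) cat \<Rightarrow> 'm \<Rightarrow> 'm \<Rightarrow> bool" where
  "short_exact C f g \<longleftrightarrow> is_kernel C g f \<and> is_cokernel C f g"

definition additive_functor ::
  "('o, 'm) cat \<Rightarrow> ('p, 'n) cat \<Rightarrow> ('o \<Rightarrow> 'p) \<Rightarrow> ('m \<Rightarrow> 'n) \<Rightarrow> bool" where
  "additive_functor C D T t \<longleftrightarrow>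
     (\<forall>X \<in> Obj C. T X \<in> Obj D \<and> t (Id C X) = Id D (T X)) \<and>
     (\<forall>X Y. \<forall>f \<in> Hom C X Y. t f \<in> Hom D (T X) (T Y)) \<and>
     (\<forall>X Y Z. \<forall>f \<in> Hom C X Y. \<forall>g \<in> Hom C Y Z. t (g \<cdot>\<^bsub>C\<^esub> f) = t g \<cdot>\<^bsub>D\<^esub> t f) \<and>
     (\<forall>X Y. \<forall>f \<in> Hom C X Y. \<forall>g \<in> Hom C X Y. t (Plus C f g) = Plus D (t f) (t g))"

definition exact_functor ::
  "('o, 'm) cat \<Rightarrow> ('p, 'n) cat \<Rightarrow> ('o \<Rightarrow> 'p) \<Rightarrow> ('m \<Rightarrow> 'n) \<Rightarrow> bool" where
  "exact_functor C D T t \<longleftrightarrow> additive_functor C D T t \<and>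
     (\<forall>f g. short_exact C f g \<longrightarrow> short_exact D (t f) (t g))"

section \<open>Coproducts, products and classes of objects\<close>

definition is_coproduct ::
  "('o, 'm) cat \<Rightarrow> 'i set \<Rightarrow> ('i \<Rightarrow> 'o) \<Rightarrow> 'o \<Rightarrow> ('i \<Rightarrow> 'm) \<Rightarrow> bool" where
  "is_coproduct C I A P \<iota> \<longleftrightarrow> P \<in> Obj C \<and> (\<forall>i \<in> I. \<iota> i \<in> Hom C (A i) P) \<and>
     (\<forall>X \<in> Obj C. \<forall>f. (\<forall>i \<in> I. f i \<in> Hom C (A i) X) \<longrightarrow>
        (\<exists>!h. h \<in> Hom C P X \<and> (\<forall>i \<in> I. h \<cdot>\<^bsub>C\<^esub> \<iota> i = f i)))"

definition is_product ::
  "('o, 'm) cat \<Rightarrow> 'i set \<Rightarrow> ('i \<Rightarrow> 'o) \<Rightarrow> 'o \<Rightarrow> ('i \<Rightarrow> 'm) \<Rightarrow> bool" where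
  "is_product C I A P \<pi> \<longleftrightarrow> P \<in> Obj C \<and> (\<forall>i \<in> I. \<pi> i \<in> Hom C P (A i)) \<and>
     (\<forall>X \<in> Obj C. \<forall>f. (\<forall>i \<in> I. f i \<in> Hom C X (A i)) \<longrightarrow>
        (\<exists>!h. h \<in> Hom C X P \<and> (\<forall>i \<in> I. \<pi> i \<cdot>\<^bsub>C\<^esub> h = f i)))"

text \<open>A cardinal is a \<^const>\<open>Card_order\<close> \<open>\<kappa> :: 'k rel\<close>. Every set of cardinality at most
  \<open>\<kappa>\<close>, of whatever type, is in bijection with a subset of \<open>Field \<kappa>\<close>, so it suffices to let
  index sets range over \<open>'k set\<close>.\<close>

definition AB3 :: "'k rel \<Rightarrow> ('o, 'm) cat \<Rightarrow> bool" where
  "AB3 \<kappa> C \<longleftrightarrow> (\<forall>(I :: 'k set) A. |I| <o \<kappa> \<and> (\<forall>i \<in> I. A i \<in> Obj C) \<longrightarrow>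
     (\<exists>P \<iota>. is_coproduct C I A P \<iota>))"

definition AB3_star :: "'k rel \<Rightarrow> ('o, 'm) cat \<Rightarrow> bool" where
  "AB3_star \<kappa> C \<longleftrightarrow> (\<forall>(I :: 'k set) A. |I| <o \<kappa> \<and> (\<forall>i \<in> I. A i \<in> Obj C) \<longrightarrow>
     (\<exists>P \<pi>. is_product C I A P \<pi>))"

definition generating :: "('o, 'm) cat \<Rightarrow> 'o set \<Rightarrow> bool" where
  "generating C U \<longleftrightarrow> U \<subseteq> Obj C \<and>
     (\<forall>X \<in> Obj C. \<exists>A \<in> U. \<exists>e \<in> Hom C A X. epi_arr C e)"

definition projective :: "('o, 'm) cat \<Rightarrow> 'o \<Rightarrow> bool" where
  "projective C P \<longleftrightarrow> P \<in> Obj C \<and>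
     (\<forall>X Y. \<forall>e \<in> Hom C X Y. \<forall>f \<in> Hom C P Y.
        epi_arr C e \<longrightarrow> (\<exists>h \<in> Hom C P X. e \<cdot>\<^bsub>C\<^esub> h = f))"

definition Proj :: "('o, 'm) cat \<Rightarrow> 'o set" where
  "Proj C = {P. projective C P}"

definition enough_projectives :: "('o, 'm) cat \<Rightarrow> bool" where
  "enough_projectives C \<longleftrightarrow> (\<forall>X \<in> Obj C. \<exists>P \<in> Proj C. \<exists>e \<in> Hom C P X. epi_arr C e)"

definition Coprod_le :: "('o, 'm) cat \<Rightarrow> 'k rel \<Rightarrow> 'o set \<Rightarrow> 'o set" where
  "Coprod_le C \<kappa> \<X> = {P. \<exists>(I :: 'k set) A \<iota>. |I| \<le>o \<kappa> \<and> (\<forall>i \<in> I. A i \<in> \<X>) \<and> is_coproduct C I A P \<iota>}"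

definition direct_summand :: "('o, 'm) cat \<Rightarrow> 'o \<Rightarrow> 'o \<Rightarrow> bool" where
  "direct_summand C X B \<longleftrightarrow> (\<exists>Y i j p q. is_biproduct C X Y B i j p q)"

definition Add_le :: "('o, 'm) cat \<Rightarrow> 'k rel \<Rightarrow> 'o set \<Rightarrow> 'o set" where
  "Add_le C \<kappa> \<X> = {X. \<exists>B \<in> Coprod_le C \<kappa> \<X>. direct_summand C X B}"

section \<open>Quivers\<close>

record ('v, 'a) quiver =
  Vert :: "'v set"
  Arrow :: "'a set"
  src :: "'a \<Rightarrow> 'v"
  tgt :: "'a \<Rightarrow> 'v"

locale quiver =
  fixes Q :: "('v, 'a) quiver"
  assumes src_Vert: "\<alpha> \<in> Arrow Q \<Longrightarrow> src Q \<alpha> \<in> Vert Q"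
    and tgt_Vert: "\<alpha> \<in> Arrow Q \<Longrightarrow> tgt Q \<alpha> \<in> Vert Q"

text \<open>A path is its starting vertex together with the list of its arrows in the order in which
  they are traversed; thus \<open>(i, [])\<close> is the trivial path at \<open>i\<close>.\<close>

type_synonym ('v, 'a) path = "'v \<times> 'a list"

fun walk :: "('v, 'a) quiver \<Rightarrow> 'v \<Rightarrow> 'a list \<Rightarrow> 'v \<Rightarrow> bool" where
  "walk Q i [] j \<longleftrightarrow> i \<in> Vert Q \<and> i = j"
| "walk Q i (\<alpha> # \<rho>) j \<longleftrightarrow> \<alpha> \<in> Arrow Q \<and> src Q \<alpha> = i \<and> walk Q (tgt Q \<alpha>) \<rho> j"

definition paths :: "('v, 'a) quiver \<Rightarrow> 'v \<Rightarrow> 'v \<Rightarrow> ('v, 'a) path set" where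
  "paths Q i j = {(i, \<rho>) | \<rho>. walk Q i \<rho> j}"

definition paths_to :: "('v, 'a) quiver \<Rightarrow> 'v \<Rightarrow> ('v, 'a) path set" where
  "paths_to Q j = (\<Union>i \<in> Vert Q. paths Q i j)"

text \<open>Arrows compose like functions: \<open>after_path \<alpha> \<rho>\<close> is \<open>\<alpha>\<rho>\<close> (first \<open>\<rho>\<close>, then \<open>\<alpha>\<close>) and
  \<open>before_path Q \<rho> \<alpha>\<close> is \<open>\<rho>\<alpha>\<close> (first \<open>\<alpha>\<close>, then \<open>\<rho>\<close>).\<close>

definition after_path :: "'a \<Rightarrow> ('v, 'a) path \<Rightarrow> ('v, 'a) path" where
  "after_path \<alpha> \<rho> = (fst \<rho>, snd \<rho> @ [\<alpha>])"

definition before_path :: "('v, 'a) quiver \<Rightarrow> ('v, 'a) path \<Rightarrow> 'a \<Rightarrow> ('v, 'a) path" where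
  "before_path Q \<rho> \<alpha> = (src Q \<alpha>, \<alpha> # snd \<rho>)"

section \<open>Cardinal invariants of a quiver\<close>

text \<open>The supremum of a set of cardinals on a type \<open>'c\<close>. It exists on the same type, because
  \<open>|UNIV :: 'c set|\<close> is an upper bound.\<close>

definition card_Sup :: "'c rel set \<Rightarrow> 'c rel" where
  "card_Sup X = (SOME s. Card_order s \<and> (\<forall>x \<in> X. x \<le>o s) \<and>
     (\<forall>t :: 'c rel. Card_order t \<and> (\<forall>x \<in> X. x \<le>o t) \<longrightarrow> s \<le>o t))"

text \<open>Successor cardinals of cardinals on \<open>'c\<close> live on the type \<open>'c set\<close>; in the other case the
  supremum is moved to that type along \<open>c \<mapsto> {c}\<close>.\<close>

definition card_size :: "'c rel set \<Rightarrow> 'c set rel" where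
  "card_size X = (if \<forall>x \<in> X. x <o card_Sup X then |(\<lambda>c. {c}) ` Field (card_Sup X)|
     else cardSuc (card_Sup X))"

definition rccn :: "('v, 'a) quiver \<Rightarrow> ('v, 'a) path set rel" where
  "rccn Q = card_Sup {card_size {|paths Q i j| | j. j \<in> Vert Q} | i. i \<in> Vert Q}"

definition lccn :: "('v, 'a) quiver \<Rightarrow> ('v, 'a) path set rel" where
  "lccn Q = card_Sup {card_size {|paths Q j i| | j. j \<in> Vert Q} | i. i \<in> Vert Q}"

definition ltccn :: "('v, 'a) quiver \<Rightarrow> ('v, 'a) path set rel" where
  "ltccn Q = card_size {|paths_to Q i| | i. i \<in> Vert Q}"

section \<open>Representations\<close>

record ('v, 'a, 'o, 'm) rep =
  at_vert :: "'v \<Rightarrow> 'o"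
  at_arrow :: "'a \<Rightarrow> 'm"

record ('v, 'a, 'o, 'm) rep_hom =
  rdom :: "('v, 'a, 'o, 'm) rep"
  rcod :: "('v, 'a, 'o, 'm) rep"
  comp_at :: "'v \<Rightarrow> 'm"

text \<open>Families indexed by vertices or arrows are extensional, so that equality of representations
  and of their morphisms is equality of the families on the vertices and arrows of \<open>Q\<close>.\<close>

definition reps :: "('v, 'a) quiver \<Rightarrow> ('o, 'm) cat \<Rightarrow> ('v, 'a, 'o, 'm) rep set" where
  "reps Q C = {F. at_vert F \<in> Vert Q \<rightarrow>\<^sub>E Obj C \<and>
     at_arrow F \<in> (\<Pi>\<^sub>E \<alpha> \<in> Arrow Q. Hom C (at_vert F (src Q \<alpha>)) (at_vert F (tgt Q \<alpha>)))}"

definition rep_homs :: "('v, 'a) quiver \<Rightarrow> ('o, 'm) cat \<Rightarrow> ('v, 'a, 'o, 'm) rep_hom set" where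
  "rep_homs Q C = {\<phi>. rdom \<phi> \<in> reps Q C \<and> rcod \<phi> \<in> reps Q C \<and>
     comp_at \<phi> \<in> (\<Pi>\<^sub>E i \<in> Vert Q. Hom C (at_vert (rdom \<phi>) i) (at_vert (rcod \<phi>) i)) \<and>
     (\<forall>\<alpha> \<in> Arrow Q. comp_at \<phi> (tgt Q \<alpha>) \<cdot>\<^bsub>C\<^esub> at_arrow (rdom \<phi>) \<alpha>
        = at_arrow (rcod \<phi>) \<alpha> \<cdot>\<^bsub>C\<^esub> comp_at \<phi> (src Q \<alpha>))}"

definition Rep :: "('v, 'a) quiver \<Rightarrow> ('o, 'm) cat \<Rightarrow>
    (('v, 'a, 'o, 'm) rep, ('v, 'a, 'o, 'm) rep_hom) cat" where
  "Rep Q C = \<lparr>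
     Obj = reps Q C,
     Arr = rep_homs Q C,
     Dom = rdom,
     Cod = rcod,
     Id = (\<lambda>F. \<lparr>rdom = F, rcod = F, comp_at = (\<lambda>i \<in> Vert Q. Id C (at_vert F i))\<rparr>),
     Comp = (\<lambda>\<psi> \<phi>. \<lparr>rdom = rdom \<phi>, rcod = rcod \<psi>,
               comp_at = (\<lambda>i \<in> Vert Q. comp_at \<psi> i \<cdot>\<^bsub>C\<^esub> comp_at \<phi> i)\<rparr>),
     Plus = (\<lambda>\<phi> \<psi>. \<lparr>rdom = rdom \<phi>, rcod = rcod \<phi>,
               comp_at = (\<lambda>i \<in> Vert Q. Plus C (comp_at \<phi> i) (comp_at \<psi> i))\<rparr>),
     Zero = (\<lambda>F G. \<lparr>rdom = F, rcod = G,
               comp_at = (\<lambda>i \<in> Vert Q. Zero C (at_vert F i) (at_vert G i))\<rparr>)\<rparr>"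

definition Supp :: "('v, 'a) quiver \<Rightarrow> ('o, 'm) cat \<Rightarrow> ('v, 'a, 'o, 'm) rep \<Rightarrow> 'v set" where
  "Supp Q C F = {i \<in> Vert Q. \<not> zero_obj C (at_vert F i)}"

section \<open>The functors \<open>f\<^sub>i\<close> and \<open>g\<^sub>i\<close>\<close>

text \<open>\<open>copower_obj C I X\<close> and \<open>power_obj C I X\<close> are a chosen coproduct \<open>X\<^sup>(\<^sup>I\<^sup>)\<close> with its inclusions and a
  chosen product \<open>X\<^sup>I\<close> with its projections. They are meaningful whenever the coproduct,
  resp. product, exists.\<close>

definition copower_obj :: "('o, 'm) cat \<Rightarrow> 'i set \<Rightarrow> 'o \<Rightarrow> 'o \<times> ('i \<Rightarrow> 'm)" where
  "copower_obj C I X = (SOME (P, \<mu>). is_coproduct C I (\<lambda>_. X) P \<mu>)"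

definition power_obj :: "('o, 'm) cat \<Rightarrow> 'i set \<Rightarrow> 'o \<Rightarrow> 'o \<times> ('i \<Rightarrow> 'm)" where
  "power_obj C I X = (SOME (P, \<pi>). is_product C I (\<lambda>_. X) P \<pi>)"

definition f_vert :: "('v, 'a) quiver \<Rightarrow> ('o, 'm) cat \<Rightarrow> 'v \<Rightarrow> 'o \<Rightarrow> 'v \<Rightarrow> 'o" where
  "f_vert Q C i X j = fst (copower_obj C (paths Q i j) X)"

definition incl :: "('v, 'a) quiver \<Rightarrow> ('o, 'm) cat \<Rightarrow> 'v \<Rightarrow> 'o \<Rightarrow> 'v \<Rightarrow> ('v, 'a) path \<Rightarrow> 'm" where
  "incl Q C i X j = snd (copower_obj C (paths Q i j) X)"

definition f_obj :: "('v, 'a) quiver \<Rightarrow> ('o, 'm) cat \<Rightarrow> 'v \<Rightarrow> 'o \<Rightarrow> ('v, 'a, 'o, 'm) rep" where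
  "f_obj Q C i X = \<lparr>
     at_vert = (\<lambda>j \<in> Vert Q. f_vert Q C i X j),
     at_arrow = (\<lambda>\<alpha> \<in> Arrow Q. THE h.
       h \<in> Hom C (f_vert Q C i X (src Q \<alpha>)) (f_vert Q C i X (tgt Q \<alpha>)) \<and>
       (\<forall>\<rho> \<in> paths Q i (src Q \<alpha>).
          h \<cdot>\<^bsub>C\<^esub> incl Q C i X (src Q \<alpha>) \<rho> = incl Q C i X (tgt Q \<alpha>) (after_path \<alpha> \<rho>)))\<rparr>"

definition f_star :: "('v, 'a) quiver \<Rightarrow> ('o, 'm) cat \<Rightarrow> 'o set \<Rightarrow> ('v, 'a, 'o, 'm) rep set" where
  "f_star Q C \<S> = {f_obj Q C i S | i S. i \<in> Vert Q \<and> S \<in> \<S>}"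

definition g_vert :: "('v, 'a) quiver \<Rightarrow> ('o, 'm) cat \<Rightarrow> 'v \<Rightarrow> 'o \<Rightarrow> 'v \<Rightarrow> 'o" where
  "g_vert Q C i X j = fst (power_obj C (paths Q j i) X)"

definition proj :: "('v, 'a) quiver \<Rightarrow> ('o, 'm) cat \<Rightarrow> 'v \<Rightarrow> 'o \<Rightarrow> 'v \<Rightarrow> ('v, 'a) path \<Rightarrow> 'm" where
  "proj Q C i X j = snd (power_obj C (paths Q j i) X)"

definition g_obj :: "('v, 'a) quiver \<Rightarrow> ('o, 'm) cat \<Rightarrow> 'v \<Rightarrow> 'o \<Rightarrow> ('v, 'a, 'o, 'm) rep" where
  "g_obj Q C i X = \<lparr>
     at_vert = (\<lambda>j \<in> Vert Q. g_vert Q C i X j),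
     at_arrow = (\<lambda>\<alpha> \<in> Arrow Q. THE h.
       h \<in> Hom C (g_vert Q C i X (src Q \<alpha>)) (g_vert Q C i X (tgt Q \<alpha>)) \<and>
       (\<forall>\<rho> \<in> paths Q (tgt Q \<alpha>) i.
          proj Q C i X (tgt Q \<alpha>) \<rho> \<cdot>\<^bsub>C\<^esub> h = proj Q C i X (src Q \<alpha>) (before_path Q \<rho> \<alpha>)))\<rparr>"

definition g_arr :: "('v, 'a) quiver \<Rightarrow> ('o, 'm) cat \<Rightarrow> 'v \<Rightarrow> 'm \<Rightarrow> ('v, 'a, 'o, 'm) rep_hom" where
  "g_arr Q C i u = \<lparr>
     rdom = g_obj Q C i (Dom C u),
     rcod = g_obj Q C i (Cod C u),
     comp_at = (\<lambda>j \<in> Vert Q. THE h.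
       h \<in> Hom C (g_vert Q C i (Dom C u) j) (g_vert Q C i (Cod C u) j) \<and>
       (\<forall>\<rho> \<in> paths Q j i.
          proj Q C i (Cod C u) j \<rho> \<cdot>\<^bsub>C\<^esub> h = u \<cdot>\<^bsub>C\<^esub> proj Q C i (Dom C u) j \<rho>))\<rparr>"

end

(* Evaluation at a vertex i is right adjoint to f_i and left adjoint to g_i: by the Yoneda-like
   formula phi_j o mu_rho = F_rho o (phi_i o mu_(trivial)), a morphism f_i(X) -> F is freely given
   by X -> F_i. Kernels, cokernels and coproducts of representations are pointwise, and the
   coproduct of the f_i(U_i) at j is a coproduct over the paths ending at j, which is where the
   bound on ltccn(Q) enters. Epimorphisms U_i -> F_i therefore assemble to an epimorphism from the
   coproduct of the f_i(U_i) onto F, and it splits when F is projective. Under the hypotheses of (d),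
   evaluation at i preserves projectives, so one may take U_i = F_i. *)

theory Submission
  imports Defs
begin


section \<open>Cardinal invariants\<close>

text \<open>The index set Supp(F) may have \<kappa> or more elements, so AB3(\<kappa>) gives no
  coproduct over it directly. It is enough to have one at each vertex j, and there a vertex i
  contributes one copy of U_i for every path from i to j; fewer than \<kappa> paths end at j, and
  vertices without such a path contribute a zero object. This is also why the strictness of
  \<open>size\<close> matters: AB3(\<kappa>) speaks of fewer than \<kappa> summands, and size(X)
  lies strictly above every member of X. Before f_i can be seen to preserve projectives, evaluation
  at a vertex must be known to preserve epimorphisms. That is the harder half of the pointwise
  criterion, and it comes from cokernels built vertex by vertex. To split off a projective F, the
  kernel of the split epimorphism serves as the complement in a biproduct. The upper bounds for
  Proj(Rep(Q,C)) differ only in how the F_i are covered: by projectives of C, by arbitrary objects,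
  or by the F_i themselves once these are known to be projective.\<close>

lemma card_Sup_spec:
  fixes X :: "'c rel set"
  assumes "\<And>x. x \<in> X \<Longrightarrow> Card_order x"
  shows "Card_order (card_Sup X) \<and> (\<forall>x \<in> X. x \<le>o card_Sup X) \<and>
     (\<forall>t :: 'c rel. Card_order t \<and> (\<forall>x \<in> X. x \<le>o t) \<longrightarrow> card_Sup X \<le>o t)"
proof -
  let ?S = "{s :: 'c rel. Card_order s \<and> (\<forall>x \<in> X. x \<le>o s)}"
  have "x \<le>o |UNIV :: 'c set|" if "x \<in> X" for x
    using card_of_Field_ordIso[OF assms[OF that]] card_of_mono1[of "Field x" UNIV]
    by (meson ordIso_ordLeq_trans ordIso_symmetric subset_UNIV)
  then have "|UNIV :: 'c set| \<in> ?S"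
    using card_of_Card_order by blast
  \<comment> \<open>Cardinals are well-ordered by \<open>\<le>o\<close>, so the nonempty set of
    upper bounds has a least element.\<close>
  then obtain s where "s \<in> ?S" "\<forall>t \<in> ?S. s \<le>o t"
    using exists_minim_Card_order[of ?S] by blast
  then have "\<exists>s :: 'c rel. Card_order s \<and> (\<forall>x \<in> X. x \<le>o s) \<and>
     (\<forall>t :: 'c rel. Card_order t \<and> (\<forall>x \<in> X. x \<le>o t) \<longrightarrow> s \<le>o t)"
    by blast
  then show ?thesis
    unfolding card_Sup_def by (rule someI_ex)
qed

lemma Card_order_card_size:
  assumes "\<And>x. x \<in> X \<Longrightarrow> Card_order x"
  shows "Card_order (card_size X)"
  using card_Sup_spec[OF assms] by (auto simp: card_size_def cardSuc_Card_order card_of_Card_order)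

text \<open>The two cases of \<open>card_size\<close> serve this purpose: a supremum that no member
  attains already lies above all of them, and otherwise its successor does.\<close>

lemma card_size_greater:
  fixes X :: "'c rel set"
  assumes X: "\<And>x. x \<in> X \<Longrightarrow> Card_order x" and x: "x \<in> X"
  shows "x <o card_size X"
proof (cases "\<forall>x \<in> X. x <o card_Sup X")
  case True
  \<comment> \<open>Passing from \<open>c\<close> to \<open>{c}\<close> changes the type of the
    cardinal, not its size.\<close>
  have "|(\<lambda>c. {c}) ` Field (card_Sup X)| =o |Field (card_Sup X)|"
    by (rule ordIso_symmetric, rule card_of_ordIsoI[of "\<lambda>c. {c}"]) (simp add: bij_betw_def)
  then have "card_Sup X =o |(\<lambda>c. {c}) ` Field (card_Sup X)|"
    using card_of_Field_ordIso card_Sup_spec[of X, OF X] ordIso_symmetric ordIso_transitive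
    by blast
  then show ?thesis
    using True x by (auto simp: card_size_def intro: ordLess_ordIso_trans)
next
  case False
  have "x \<le>o card_Sup X" "card_Sup X <o cardSuc (card_Sup X)"
    using card_Sup_spec[of X, OF X] x by (auto intro: cardSuc_greater)
  then have "x <o cardSuc (card_Sup X)"
    by (rule ordLeq_ordLess_trans)
  then show ?thesis
    unfolding card_size_def if_not_P[OF False] .
qed

text \<open>Shared by \<open>rccn\<close> and \<open>lccn\<close>: \<open>X i\<close> will be the
  set of path cardinals at the vertex \<open>i\<close>, and the strict bound by
  \<open>card_size (X i)\<close> survives the supremum over \<open>i\<close>.\<close>

lemma card_size_less_Sup:
  fixes X :: "'i \<Rightarrow> 'c rel set"
  assumes "\<And>i x. x \<in> X i \<Longrightarrow> Card_order x" and "i \<in> I" and "x \<in> X i"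
    and "card_Sup {card_size (X i) | i. i \<in> I} \<le>o \<kappa>"
  shows "x <o \<kappa>"
proof -
  have "card_size (X i) \<le>o card_Sup {card_size (X i) | i. i \<in> I}"
    using card_Sup_spec[of "{card_size (X i) | i. i \<in> I}"] Card_order_card_size assms(1,2)
    by blast
  then show ?thesis
    using card_size_greater[of "X i" x] assms
    by (meson ordLess_ordLeq_trans)
qed

lemma card_paths_less_rccn:
  assumes "rccn Q \<le>o \<kappa>" and "i \<in> Vert Q" and "j \<in> Vert Q"
  shows "|paths Q i j| <o \<kappa>"
  using assms
  by (intro card_size_less_Sup[of "\<lambda>i. {|paths Q i j| | j. j \<in> Vert Q}" i "Vert Q"])
    (auto simp: rccn_def card_of_Card_order)

lemma card_paths_less_lccn:
  assumes "lccn Q \<le>o \<kappa>" and "i \<in> Vert Q" and "j \<in> Vert Q"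
  shows "|paths Q j i| <o \<kappa>"
  using assms
  by (intro card_size_less_Sup[of "\<lambda>i. {|paths Q j i| | j. j \<in> Vert Q}" i "Vert Q"])
    (auto simp: lccn_def card_of_Card_order)

lemma card_paths_to_less_ltccn:
  assumes "ltccn Q \<le>o \<kappa>" and "i \<in> Vert Q"
  shows "|paths_to Q i| <o \<kappa>"
proof -
  have "|paths_to Q i| <o card_size {|paths_to Q i| | i. i \<in> Vert Q}"
    using assms(2) by (intro card_size_greater) (auto simp: card_of_Card_order)
  then show ?thesis
    using assms(1) ordLess_ordLeq_trans unfolding ltccn_def by blast
qed

text \<open>\<open>AB3 \<kappa>\<close> speaks of index sets inside the type of \<kappa>, while the
  families below are indexed by paths. Such an injection carries a small index set over.\<close>

lemma inj_into_Field_of_ordLess: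
  fixes I :: "'i set" and \<kappa> :: "'k rel"
  assumes "|I| <o \<kappa>" and "Card_order \<kappa>"
  obtains b :: "'i \<Rightarrow> 'k" where "inj_on b I" and "|b ` I| <o \<kappa>"
proof -
  have "|I| \<le>o |Field \<kappa>|"
    using assms card_of_Field_ordIso ordIso_symmetric ordLeq_ordIso_trans ordLess_imp_ordLeq
    by blast
  then obtain b :: "'i \<Rightarrow> 'k" where b: "inj_on b I" "b ` I \<subseteq> Field \<kappa>"
    using card_of_ordLeq by metis
  have "|b ` I| <o \<kappa>"
    using card_of_image assms(1) ordLeq_ordLess_trans by blast
  with b(1) show thesis
    by (rule that)
qed

section \<open>Categories\<close>

context category
begin

lemma Hom_Obj: "f \<in> Hom C X Y \<Longrightarrow> X \<in> Obj C \<and> Y \<in> Obj C"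
  using Dom_Obj Cod_Obj by (auto simp: Hom_def)

lemma epi_cancel:
  assumes "epi_arr C e" and "e \<in> Hom C A B" and "u \<in> Hom C B X" and "v \<in> Hom C B X"
    and "u \<cdot> e = v \<cdot> e"
  shows "u = v"
  using assms by (auto simp: epi_arr_def Hom_def)

lemma epiI:
  assumes "e \<in> Hom C A B"
    and "\<And>X u v. \<lbrakk>u \<in> Hom C B X; v \<in> Hom C B X; u \<cdot> e = v \<cdot> e\<rbrakk> \<Longrightarrow> u = v"
  shows "epi_arr C e"
  using assms by (auto simp: epi_arr_def Hom_def)

lemma epi_of_epi_Comp:
  assumes f: "f \<in> Hom C X Y" and g: "g \<in> Hom C Y Z" and e: "epi_arr C (g \<cdot> f)"
  shows "epi_arr C g"
proof (rule epiI[OF g])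
  fix W u v
  assume u: "u \<in> Hom C Z W" and v: "v \<in> Hom C Z W" and uv: "u \<cdot> g = v \<cdot> g"
  have "u \<cdot> (g \<cdot> f) = v \<cdot> (g \<cdot> f)"
    using Comp_assoc[OF f g u] Comp_assoc[OF f g v] uv by simp
  then show "u = v"
    using epi_cancel[OF e Comp_Hom[OF f g] u v] by blast
qed

lemma epi_Id: "X \<in> Obj C \<Longrightarrow> epi_arr C (Id C X)"
  by (rule epiI[OF Id_Hom]) (auto simp: Comp_Id_right)

lemma epi_to_zero_obj:
  assumes "zero_obj C Z" and "f \<in> Hom C X Z"
  shows "epi_arr C f"
  using assms by (intro epiI) (auto simp: zero_obj_def dest: Hom_Obj)

subsection \<open>Coproducts and products\<close>

lemma coproductI:
  assumes "P \<in> Obj C" and "\<And>i. i \<in> I \<Longrightarrow> \<iota> i \<in> Hom C (A i) P"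
    and "\<And>X f. \<lbrakk>X \<in> Obj C; \<And>i. i \<in> I \<Longrightarrow> f i \<in> Hom C (A i) X\<rbrakk>
      \<Longrightarrow> \<exists>h. h \<in> Hom C P X \<and> (\<forall>i \<in> I. h \<cdot> \<iota> i = f i)"
    and "\<And>X h k. \<lbrakk>h \<in> Hom C P X; k \<in> Hom C P X; \<And>i. i \<in> I \<Longrightarrow> h \<cdot> \<iota> i = k \<cdot> \<iota> i\<rbrakk> \<Longrightarrow> h = k"
  shows "is_coproduct C I A P \<iota>"
  unfolding is_coproduct_def
proof (intro conjI ballI allI impI)
  fix X f
  assume X: "X \<in> Obj C" and f: "\<forall>i \<in> I. f i \<in> Hom C (A i) X"
  obtain h where "h \<in> Hom C P X" "\<forall>i \<in> I. h \<cdot> \<iota> i = f i"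
    using assms(3)[OF X, of f] f by blast
  then show "\<exists>!h. h \<in> Hom C P X \<and> (\<forall>i \<in> I. h \<cdot> \<iota> i = f i)"
    using assms(4) by (intro ex1I[of _ h]) auto
qed (use assms in auto)

lemma coproduct_Hom: "\<lbrakk>is_coproduct C I A P \<iota>; i \<in> I\<rbrakk> \<Longrightarrow> \<iota> i \<in> Hom C (A i) P"
  by (simp add: is_coproduct_def)

lemma coproduct_desc:
  assumes "is_coproduct C I A P \<iota>" and "X \<in> Obj C" and "\<And>i. i \<in> I \<Longrightarrow> f i \<in> Hom C (A i) X"
  obtains h where "h \<in> Hom C P X" and "\<And>i. i \<in> I \<Longrightarrow> h \<cdot> \<iota> i = f i"
proof -
  have "\<exists>!h. h \<in> Hom C P X \<and> (\<forall>i \<in> I. h \<cdot> \<iota> i = f i)"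
    using assms unfolding is_coproduct_def by blast
  then show thesis
    using that by blast
qed

lemma coproduct_ext:
  assumes P: "is_coproduct C I A P \<iota>" and h: "h \<in> Hom C P X" and k: "k \<in> Hom C P X"
    and eq: "\<And>i. i \<in> I \<Longrightarrow> h \<cdot> \<iota> i = k \<cdot> \<iota> i"
  shows "h = k"
proof -
  have "\<forall>i \<in> I. h \<cdot> \<iota> i \<in> Hom C (A i) X"
    using P h Comp_Hom unfolding is_coproduct_def by blast
  then have "\<exists>!l. l \<in> Hom C P X \<and> (\<forall>i \<in> I. l \<cdot> \<iota> i = h \<cdot> \<iota> i)"
    using P Hom_Obj[OF h] by (simp add: is_coproduct_def)
  then show ?thesis
    using h k eq by metis
qed

lemma coproduct_reindex:
  assumes "inj_on b I" and "is_coproduct C (b ` I) (\<lambda>j. A (inv_into I b j)) P \<iota>"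
  shows "is_coproduct C I A P (\<lambda>i. \<iota> (b i))"
  unfolding is_coproduct_def
proof (intro conjI ballI allI impI)
  fix X f
  assume "X \<in> Obj C" and "\<forall>i \<in> I. f i \<in> Hom C (A i) X"
  \<comment> \<open>The test family on the image of \<open>b\<close> is \<open>f\<close> composed
    with the inverse of \<open>b\<close>.\<close>
  then have "\<exists>!h. h \<in> Hom C P X \<and> (\<forall>j \<in> b ` I. h \<cdot> \<iota> j = f (inv_into I b j))"
    using assms unfolding is_coproduct_def
    by (elim conjE ballE[of _ _ X] allE[of _ "\<lambda>j. f (inv_into I b j)"]) auto
  then show "\<exists>!h. h \<in> Hom C P X \<and> (\<forall>i \<in> I. h \<cdot> \<iota> (b i) = f i)"
    using assms(1) by simp
qed (use assms in \<open>auto simp: is_coproduct_def\<close>)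

lemma product_reindex:
  assumes "inj_on b I" and "is_product C (b ` I) (\<lambda>j. A (inv_into I b j)) P \<pi>"
  shows "is_product C I A P (\<lambda>i. \<pi> (b i))"
  unfolding is_product_def
proof (intro conjI ballI allI impI)
  fix X f
  assume "X \<in> Obj C" and "\<forall>i \<in> I. f i \<in> Hom C X (A i)"
  then have "\<exists>!h. h \<in> Hom C X P \<and> (\<forall>j \<in> b ` I. \<pi> j \<cdot> h = f (inv_into I b j))"
    using assms unfolding is_product_def
    by (elim conjE ballE[of _ _ X] allE[of _ "\<lambda>j. f (inv_into I b j)"]) auto
  then show "\<exists>!h. h \<in> Hom C X P \<and> (\<forall>i \<in> I. \<pi> (b i) \<cdot> h = f i)"
    using assms(1) by simp
qed (use assms in \<open>auto simp: is_product_def\<close>)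

lemma AB3_ex_coproduct:
  fixes \<kappa> :: "'k rel" and I :: "'i set"
  assumes "AB3 \<kappa> C" and "Card_order \<kappa>" and "|I| <o \<kappa>" and "\<And>i. i \<in> I \<Longrightarrow> A i \<in> Obj C"
  shows "\<exists>P \<iota>. is_coproduct C I A P \<iota>"
proof -
  obtain b :: "'i \<Rightarrow> 'k" where b: "inj_on b I" "|b ` I| <o \<kappa>"
    using inj_into_Field_of_ordLess assms(2,3) by blast
  have "\<exists>P \<iota>. is_coproduct C (b ` I) (\<lambda>j. A (inv_into I b j)) P \<iota>"
    using assms(1)[unfolded AB3_def, rule_format, of "b ` I" "\<lambda>j. A (inv_into I b j)"] b assms(4)
    by simp
  then show ?thesis
    using coproduct_reindex[OF b(1)] by blast
qed

lemma AB3_star_ex_product: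
  fixes \<kappa> :: "'k rel" and I :: "'i set"
  assumes "AB3_star \<kappa> C" and "Card_order \<kappa>" and "|I| <o \<kappa>" and "\<And>i. i \<in> I \<Longrightarrow> A i \<in> Obj C"
  shows "\<exists>P \<pi>. is_product C I A P \<pi>"
proof -
  obtain b :: "'i \<Rightarrow> 'k" where b: "inj_on b I" "|b ` I| <o \<kappa>"
    using inj_into_Field_of_ordLess assms(2,3) by blast
  have "\<exists>P \<pi>. is_product C (b ` I) (\<lambda>j. A (inv_into I b j)) P \<pi>"
    using assms(1)[unfolded AB3_star_def, rule_format, of "b ` I" "\<lambda>j. A (inv_into I b j)"] b assms(4)
    by simp
  then show ?thesis
    using product_reindex[OF b(1)] by blast
qed

lemma product_lift:
  assumes "is_product C I A P \<pi>" and "X \<in> Obj C" and "\<And>i. i \<in> I \<Longrightarrow> f i \<in> Hom C X (A i)"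
  obtains h where "h \<in> Hom C X P" and "\<And>i. i \<in> I \<Longrightarrow> \<pi> i \<cdot> h = f i"
proof -
  have "\<exists>!h. h \<in> Hom C X P \<and> (\<forall>i \<in> I. \<pi> i \<cdot> h = f i)"
    using assms unfolding is_product_def by blast
  then show thesis
    using that by blast
qed

lemma product_ext:
  assumes P: "is_product C I A P \<pi>" and h: "h \<in> Hom C X P" and k: "k \<in> Hom C X P"
    and eq: "\<And>i. i \<in> I \<Longrightarrow> \<pi> i \<cdot> h = \<pi> i \<cdot> k"
  shows "h = k"
proof -
  have "\<forall>i \<in> I. \<pi> i \<cdot> h \<in> Hom C X (A i)"
    using P h Comp_Hom unfolding is_product_def by blast
  then have "\<exists>!l. l \<in> Hom C X P \<and> (\<forall>i \<in> I. \<pi> i \<cdot> l = \<pi> i \<cdot> h)"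
    using P Hom_Obj[OF h] by (simp add: is_product_def)
  then show ?thesis
    using h k eq by metis
qed

text \<open>Associativity of coproducts, in the direction that asks for least: only the coproduct
  over \<open>K\<close> has to exist, and the same object then serves the \<open>A i\<close>. Fibres
  of \<open>s\<close> may be empty, in which case \<open>A i\<close> is an initial object, so
  \<open>I\<close> may be far larger than \<open>K\<close>.\<close>

lemma coproduct_iterated:
  assumes s: "\<And>k. k \<in> K \<Longrightarrow> s k \<in> I"
    and A: "\<And>i. i \<in> I \<Longrightarrow> is_coproduct C {k \<in> K. s k = i} B (A i) (\<nu> i)"
    and P: "is_coproduct C K B P \<mu>"
  shows "\<exists>\<iota>. is_coproduct C I A P \<iota>"
proof -
  have PO: "P \<in> Obj C"
    using P by (simp add: is_coproduct_def)
  \<comment> \<open>\<open>\<iota> i\<close> is the arrow that the inclusions \<open>\<mu> k\<close>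
    over the fibre of \<open>i\<close> induce on \<open>A i\<close>.\<close>
  have "\<exists>h. h \<in> Hom C (A i) P \<and> (\<forall>k \<in> K. s k = i \<longrightarrow> h \<cdot> \<nu> i k = \<mu> k)" if "i \<in> I" for i
    using coproduct_desc[OF A[OF that] PO, of \<mu>] coproduct_Hom[OF P] by (smt (verit) mem_Collect_eq)
  then obtain \<iota> where \<iota>: "\<And>i. i \<in> I \<Longrightarrow> \<iota> i \<in> Hom C (A i) P"
    and \<iota>\<nu>: "\<And>k. k \<in> K \<Longrightarrow> \<iota> (s k) \<cdot> \<nu> (s k) k = \<mu> k"
    using s by metis
  have \<nu>: "\<nu> (s k) k \<in> Hom C (B k) (A (s k))" if "k \<in> K" for k
    using coproduct_Hom[OF A[OF s[OF that]], of k] that by blast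
  have assoc: "h \<cdot> \<mu> k = (h \<cdot> \<iota> (s k)) \<cdot> \<nu> (s k) k" if "k \<in> K" "h \<in> Hom C P X" for h k X
    using Comp_assoc[OF \<nu>[OF that(1)] \<iota>[OF s[OF that(1)]] that(2)] \<iota>\<nu>[OF that(1)] by simp
  have "is_coproduct C I A P \<iota>"
  proof (rule coproductI[OF PO \<iota>])
    fix X f
    assume X: "X \<in> Obj C" and f: "\<And>i. i \<in> I \<Longrightarrow> f i \<in> Hom C (A i) X"
    \<comment> \<open>Restricting the \<open>f i\<close> along the \<nu> yields a family on
      \<open>K\<close>; the arrow it induces restricts back to \<open>f i\<close> fibre by
      fibre.\<close>
    obtain h where h: "h \<in> Hom C P X" and h\<mu>: "\<And>k. k \<in> K \<Longrightarrow> h \<cdot> \<mu> k = f (s k) \<cdot> \<nu> (s k) k"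
      using coproduct_desc[OF P X, of "\<lambda>k. f (s k) \<cdot> \<nu> (s k) k"] Comp_Hom \<nu> f s
      by (metis (no_types, lifting))
    have "h \<cdot> \<iota> i = f i" if "i \<in> I" for i
    proof (rule coproduct_ext[OF A[OF that] Comp_Hom[OF \<iota>[OF that] h] f[OF that]])
      fix k assume "k \<in> {k \<in> K. s k = i}"
      then show "(h \<cdot> \<iota> i) \<cdot> \<nu> i k = f i \<cdot> \<nu> i k"
        using assoc[OF _ h, of k] h\<mu>[of k] by auto
    qed
    then show "\<exists>h. h \<in> Hom C P X \<and> (\<forall>i \<in> I. h \<cdot> \<iota> i = f i)"
      using h by blast
  next
    fix X h k
    assume h: "h \<in> Hom C P X" and k: "k \<in> Hom C P X" and eq: "\<And>i. i \<in> I \<Longrightarrow> h \<cdot> \<iota> i = k \<cdot> \<iota> i"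
    show "h = k"
      by (rule coproduct_ext[OF P h k]) (simp add: assoc[OF _ h] assoc[OF _ k] eq s)
  qed
  then show ?thesis
    by blast
qed

subsection \<open>Projective objects\<close>

lemma projective_lift:
  assumes "projective C P" and "e \<in> Hom C X Y" and "epi_arr C e" and "f \<in> Hom C P Y"
  obtains h where "h \<in> Hom C P X" and "e \<cdot> h = f"
  using assms unfolding projective_def by blast

text \<open>Each composite \<open>f \<cdot> \<iota> i\<close> is lifted on its own; the chosen lifts
  glue to a lift of \<open>f\<close>.\<close>

lemma projective_coproduct:
  assumes P: "is_coproduct C I A P \<iota>" and A: "\<And>i. i \<in> I \<Longrightarrow> projective C (A i)"
  shows "projective C P"
  unfolding projective_def
proof (intro conjI allI ballI impI)
  show "P \<in> Obj C"
    using P by (simp add: is_coproduct_def)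
  fix X Y e f
  assume e: "e \<in> Hom C X Y" and f: "f \<in> Hom C P Y" and epi: "epi_arr C e"
  have "\<exists>h. h \<in> Hom C (A i) X \<and> e \<cdot> h = f \<cdot> \<iota> i" if "i \<in> I" for i
    using projective_lift[OF A[OF that] e epi Comp_Hom[OF coproduct_Hom[OF P that] f]] by blast
  then obtain g where g: "\<And>i. i \<in> I \<Longrightarrow> g i \<in> Hom C (A i) X" "\<And>i. i \<in> I \<Longrightarrow> e \<cdot> g i = f \<cdot> \<iota> i"
    by metis
  obtain h where h: "h \<in> Hom C P X" and h\<iota>: "\<And>i. i \<in> I \<Longrightarrow> h \<cdot> \<iota> i = g i"
    using coproduct_desc[OF P _ g(1)] Hom_Obj[OF e] by blast
  have "e \<cdot> h = f"
    by (rule coproduct_ext[OF P Comp_Hom[OF h e] f])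
      (simp add: Comp_assoc[OF coproduct_Hom[OF P] h e] h\<iota> g(2))
  then show "\<exists>h \<in> Hom C P X. e \<cdot> h = f"
    using h by blast
qed

text \<open>A retract inherits lifts: lift \<open>f \<cdot> p\<close> from \<open>B\<close> and
  precompose with \<open>i\<close>.\<close>

lemma projective_direct_summand:
  assumes B: "projective C B" and P: "direct_summand C P B"
  shows "projective C P"
  unfolding projective_def
proof (intro conjI allI ballI impI)
  obtain i p where i: "i \<in> Hom C P B" and p: "p \<in> Hom C B P" and pi: "p \<cdot> i = Id C P"
    using P unfolding direct_summand_def is_biproduct_def by blast
  show "P \<in> Obj C"
    using Hom_Obj[OF i] by blast
  fix X Y e f
  assume e: "e \<in> Hom C X Y" and f: "f \<in> Hom C P Y" and epi: "epi_arr C e"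
  obtain h where h: "h \<in> Hom C B X" and eh: "e \<cdot> h = f \<cdot> p"
    using projective_lift[OF B e epi Comp_Hom[OF p f]] .
  have "e \<cdot> (h \<cdot> i) = f"
    using Comp_assoc[OF i h e] Comp_assoc[OF i p f] eh pi Comp_Id_right[OF f] by simp
  then show "\<exists>h \<in> Hom C P X. e \<cdot> h = f"
    using Comp_Hom[OF i h] by blast
qed

end

section \<open>Preadditive categories\<close>

context preadditive_category
begin

text \<open>The category record names no negation, so \<open>ex_diff\<close> takes its place:
  \<open>d\<close> is \<open>f\<close> minus \<open>g\<close>, described through
  \<open>Plus\<close>. All laws are read off one interpretation of the group theory of
  HOL-Algebra.\<close>

lemma
  assumes "X \<in> Obj C" and "Y \<in> Obj C"
  shows Zero_Hom: "Zero C X Y \<in> Hom C X Y"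
    and Plus_Hom: "\<lbrakk>f \<in> Hom C X Y; g \<in> Hom C X Y\<rbrakk> \<Longrightarrow> Plus C f g \<in> Hom C X Y"
    and Plus_assoc: "\<lbrakk>f \<in> Hom C X Y; g \<in> Hom C X Y; h \<in> Hom C X Y\<rbrakk>
      \<Longrightarrow> Plus C (Plus C f g) h = Plus C f (Plus C g h)"
    and Plus_commute: "\<lbrakk>f \<in> Hom C X Y; g \<in> Hom C X Y\<rbrakk> \<Longrightarrow> Plus C f g = Plus C g f"
    and Zero_Plus: "f \<in> Hom C X Y \<Longrightarrow> Plus C (Zero C X Y) f = f"
    and Plus_right_cancel: "\<lbrakk>f \<in> Hom C X Y; g \<in> Hom C X Y; h \<in> Hom C X Y; Plus C f h = Plus C g h\<rbrakk>
      \<Longrightarrow> f = g"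
    and ex_diff: "\<lbrakk>f \<in> Hom C X Y; g \<in> Hom C X Y\<rbrakk> \<Longrightarrow> \<exists>d \<in> Hom C X Y. Plus C d g = f"
proof -
  interpret G: comm_group "Defs.hom_group C X Y"
    using hom_group assms .
  note [simp] = Defs.hom_group_def
  show "Zero C X Y \<in> Hom C X Y"
    using G.one_closed by simp
  show "\<lbrakk>f \<in> Hom C X Y; g \<in> Hom C X Y\<rbrakk> \<Longrightarrow> Plus C f g \<in> Hom C X Y"
    using G.m_closed[of f g] by simp
  show "\<lbrakk>f \<in> Hom C X Y; g \<in> Hom C X Y; h \<in> Hom C X Y\<rbrakk>
      \<Longrightarrow> Plus C (Plus C f g) h = Plus C f (Plus C g h)"
    using G.m_assoc[of f g h] by simp
  show "\<lbrakk>f \<in> Hom C X Y; g \<in> Hom C X Y\<rbrakk> \<Longrightarrow> Plus C f g = Plus C g f"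
    using G.m_comm[of f g] by simp
  show "f \<in> Hom C X Y \<Longrightarrow> Plus C (Zero C X Y) f = f"
    using G.l_one[of f] by simp
  show "\<lbrakk>f \<in> Hom C X Y; g \<in> Hom C X Y; h \<in> Hom C X Y; Plus C f h = Plus C g h\<rbrakk> \<Longrightarrow> f = g"
    using G.right_cancel[of h f g] by simp
  show "\<exists>d \<in> Hom C X Y. Plus C d g = f" if "f \<in> Hom C X Y" "g \<in> Hom C X Y"
  proof -
    let ?G = "Defs.hom_group C X Y"
    have c: "f \<in> carrier ?G" "g \<in> carrier ?G"
      using that by simp_all
    have "(f \<otimes>\<^bsub>?G\<^esub> inv\<^bsub>?G\<^esub> g) \<otimes>\<^bsub>?G\<^esub> g = f"
      using c by (simp only: G.m_assoc G.inv_closed G.l_inv G.r_one)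
    moreover have "f \<otimes>\<^bsub>?G\<^esub> inv\<^bsub>?G\<^esub> g \<in> carrier ?G"
      using c by (intro G.m_closed G.inv_closed)
    ultimately show ?thesis
      by (metis Defs.hom_group_def monoid.select_convs(1) partial_object.select_convs(1))
  qed
qed

text \<open>Stands in for subtracting \<open>g\<close> on both sides; the zero laws of composition
  and the splitting of epimorphisms rest on it.\<close>

lemma eq_Zero_of_Plus_eq:
  assumes "f \<in> Hom C X Y" and "g \<in> Hom C X Y" and "Plus C f g = g"
  shows "f = Zero C X Y"
  using assms Plus_right_cancel[of X Y f "Zero C X Y" g] Zero_Plus Zero_Hom Hom_Obj by metis

lemma Comp_Zero:
  assumes X: "X \<in> Obj C" and g: "g \<in> Hom C Y Z"
  shows "g \<cdot> Zero C X Y = Zero C X Z"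
proof -
  have z: "Zero C X Y \<in> Hom C X Y"
    using Zero_Hom X Hom_Obj[OF g] by blast
  then have "Plus C (g \<cdot> Zero C X Y) (g \<cdot> Zero C X Y) = g \<cdot> Zero C X Y"
    using Comp_Plus_right[OF z z g] Zero_Plus[OF _ _ z] X Hom_Obj[OF g] by simp
  then show ?thesis
    using eq_Zero_of_Plus_eq Comp_Hom[OF z g] by blast
qed

lemma Zero_Comp:
  assumes Z: "Z \<in> Obj C" and f: "f \<in> Hom C X Y"
  shows "Zero C Y Z \<cdot> f = Zero C X Z"
proof -
  have z: "Zero C Y Z \<in> Hom C Y Z"
    using Zero_Hom Z Hom_Obj[OF f] by blast
  then have "Plus C (Zero C Y Z \<cdot> f) (Zero C Y Z \<cdot> f) = Zero C Y Z \<cdot> f"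
    using Comp_Plus_left[OF f z z] Zero_Plus[OF _ _ z] Z Hom_Obj[OF f] by simp
  then show ?thesis
    using eq_Zero_of_Plus_eq Comp_Hom[OF f z] by blast
qed

text \<open>If \<open>u\<close> and \<open>v\<close> agree after \<open>e\<close>, then
  \<open>e\<close> is killed by their difference, so testing against zero is enough.\<close>

lemma epi_of_Comp_eq_Zero:
  assumes e: "e \<in> Hom C X Y"
    and zero: "\<And>Z d. \<lbrakk>d \<in> Hom C Y Z; d \<cdot> e = Zero C X Z\<rbrakk> \<Longrightarrow> d = Zero C Y Z"
  shows "epi_arr C e"
proof (rule epiI[OF e])
  fix Z u v
  assume u: "u \<in> Hom C Y Z" and v: "v \<in> Hom C Y Z" and uv: "u \<cdot> e = v \<cdot> e"
  have Y: "Y \<in> Obj C" and Z: "Z \<in> Obj C"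
    using Hom_Obj[OF u] by blast+
  obtain d where d: "d \<in> Hom C Y Z" and dv: "Plus C d v = u"
    using ex_diff[OF Y Z u v] by blast
  have "Plus C (d \<cdot> e) (v \<cdot> e) = v \<cdot> e"
    using Comp_Plus_left[OF e d v] dv uv by simp
  then have "d \<cdot> e = Zero C X Z"
    using eq_Zero_of_Plus_eq Comp_Hom[OF e d] Comp_Hom[OF e v] by blast
  then have "d = Zero C Y Z"
    using zero d by blast
  then show "u = v"
    using dv Zero_Plus[OF Y Z v] by simp
qed

lemma kernel_Hom: "is_kernel C f k \<Longrightarrow> k \<in> Hom C (Dom C k) (Dom C f)"
  by (simp add: is_kernel_def Hom_def)

lemma kernel_lift:
  assumes "is_kernel C f k" and "h \<in> Hom C X (Dom C f)" and "f \<cdot> h = Zero C X (Cod C f)"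
  obtains u where "u \<in> Hom C X (Dom C k)" and "k \<cdot> u = h"
  using assms unfolding is_kernel_def by blast

text \<open>Uniqueness in \<open>is_kernel\<close> is stated for arrows that \<open>f\<close> kills,
  and \<open>k \<cdot> u\<close> is one of them.\<close>

lemma kernel_cancel:
  assumes k: "is_kernel C f k" and u: "u \<in> Hom C X (Dom C k)" and v: "v \<in> Hom C X (Dom C k)"
    and uv: "k \<cdot> u = k \<cdot> v"
  shows "u = v"
proof -
  have f: "f \<in> Hom C (Dom C f) (Cod C f)"
    using k by (simp add: is_kernel_def Hom_def)
  have "f \<cdot> (k \<cdot> u) = Zero C (Dom C k) (Cod C f) \<cdot> u"
    using k Comp_assoc[OF u kernel_Hom[OF k] f] by (simp add: is_kernel_def)
  also have "\<dots> = Zero C X (Cod C f)"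
    using Zero_Comp[OF _ u] Hom_Obj[OF f] by blast
  finally have "\<exists>!w. w \<in> Hom C X (Dom C k) \<and> k \<cdot> w = k \<cdot> u"
    using k Comp_Hom[OF u kernel_Hom[OF k]] by (simp add: is_kernel_def)
  then show ?thesis
    using u v uv by metis
qed

lemma cokernel_Hom: "is_cokernel C f q \<Longrightarrow> q \<in> Hom C (Cod C f) (Cod C q)"
  by (simp add: is_cokernel_def Hom_def)

lemma cokernel_desc:
  assumes "is_cokernel C f q" and "h \<in> Hom C (Cod C f) X" and "h \<cdot> f = Zero C (Dom C f) X"
  obtains u where "u \<in> Hom C (Cod C q) X" and "u \<cdot> q = h"
  using assms unfolding is_cokernel_def by blast

lemma cokernel_epi:
  assumes q: "is_cokernel C f q"
  shows "epi_arr C q"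
proof (rule epiI[OF cokernel_Hom[OF q]])
  fix X u v
  assume u: "u \<in> Hom C (Cod C q) X" and v: "v \<in> Hom C (Cod C q) X" and uv: "u \<cdot> q = v \<cdot> q"
  have f: "f \<in> Hom C (Dom C f) (Cod C f)"
    using q by (simp add: is_cokernel_def Hom_def)
  have "(u \<cdot> q) \<cdot> f = Zero C (Dom C f) X"
    using q Comp_assoc[OF f cokernel_Hom[OF q] u] Comp_Zero[OF _ u] Hom_Obj[OF f]
    by (simp add: is_cokernel_def)
  then have "\<exists>!w. w \<in> Hom C (Cod C q) X \<and> w \<cdot> q = u \<cdot> q"
    using q Comp_Hom[OF cokernel_Hom[OF q] u] by (simp add: is_cokernel_def)
  then show "u = v"
    using u v uv by metis
qed

text \<open>An abelian category presents an epimorphism as a cokernel of some \<open>g\<close>,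
  while \<open>short_exact\<close> asks for the cokernel of its own kernel. Since \<open>g\<close>
  factors through \<open>k\<close>, an arrow that kills \<open>k\<close> also kills \<open>g\<close>
  and so factors uniquely through \<open>e\<close>.\<close>

lemma cokernel_of_kernel:
  assumes q: "is_cokernel C g e" and k: "is_kernel C e k"
  shows "is_cokernel C k e"
  unfolding is_cokernel_def
proof (intro conjI allI ballI impI)
  have e: "e \<in> Hom C (Dom C e) (Cod C e)" and g: "g \<in> Hom C (Dom C g) (Dom C e)"
    and eg: "e \<cdot> g = Zero C (Dom C g) (Cod C e)" and cod: "Cod C g = Dom C e" "Cod C k = Dom C e"
    using q k by (auto simp: is_cokernel_def is_kernel_def Hom_def)
  show "k \<in> Arr C" "e \<in> Arr C" "Dom C e = Cod C k" "e \<cdot> k = Zero C (Dom C k) (Cod C e)"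
    using k by (auto simp: is_kernel_def)
  obtain w where w: "w \<in> Hom C (Dom C g) (Dom C k)" and kw: "k \<cdot> w = g"
    using kernel_lift[OF k g eg] .
  fix X h
  assume h: "h \<in> Hom C (Cod C k) X" and hk: "h \<cdot> k = Zero C (Dom C k) X"
  have h': "h \<in> Hom C (Dom C e) X"
    using h cod by simp
  have "h \<cdot> g = Zero C (Dom C k) X \<cdot> w"
    using Comp_assoc[OF w kernel_Hom[OF k] h'] kw hk by simp
  also have "\<dots> = Zero C (Dom C g) X"
    using Zero_Comp[OF _ w] Hom_Obj[OF h] by blast
  finally show "\<exists>!u. u \<in> Hom C (Cod C e) X \<and> u \<cdot> e = h"
    using q h' cod by (simp add: is_cokernel_def)
qed

text \<open>The complement is the kernel of \<open>e\<close>, onto which \<open>1 - s e\<close> projects.\<close>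

lemma split_epi_direct_summand:
  assumes e: "e \<in> Hom C B P" and s: "s \<in> Hom C P B" and es: "e \<cdot> s = Id C P"
    and k: "is_kernel C e k"
  shows "direct_summand C P B"
proof -
  have B: "B \<in> Obj C" and P: "P \<in> Obj C"
    using Hom_Obj[OF e] by auto
  have dom: "Dom C e = B" "Cod C e = P"
    using e by (auto simp: Hom_def)
  let ?K = "Dom C k"
  have k': "k \<in> Hom C ?K B" and ek: "e \<cdot> k = Zero C ?K P"
    using kernel_Hom[OF k] k dom by (auto simp: is_kernel_def)
  have K: "?K \<in> Obj C"
    using Hom_Obj[OF k'] by blast
  note se = Comp_Hom[OF e s]
  \<comment> \<open>\<open>d\<close> is the idempotent \<open>1 - s e\<close>, written without
    subtraction. Composing \<open>d + s e = 1\<close> with \<open>e\<close>, \<open>k\<close> and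
    \<open>s\<close> in turn gives \<open>e d = 0\<close>, \<open>d k = k\<close> and
    \<open>d s = 0\<close>.\<close>
  obtain d where d: "d \<in> Hom C B B" and d_se: "Plus C d (s \<cdot> e) = Id C B"
    using ex_diff[OF B B Id_Hom[OF B] se] by blast
  have "Plus C (e \<cdot> d) e = e"
    using Comp_Plus_right[OF d se e] d_se Comp_assoc[OF e s e] es
    by (simp add: Comp_Id_left[OF e] Comp_Id_right[OF e])
  then have ed: "e \<cdot> d = Zero C B P"
    using eq_Zero_of_Plus_eq[OF Comp_Hom[OF d e] e] by blast
  obtain q where q: "q \<in> Hom C B ?K" and kq: "k \<cdot> q = d"
    using kernel_lift[OF k, of d B] d ed dom by metis
  have sek: "(s \<cdot> e) \<cdot> k = Zero C ?K B"
    using Comp_assoc[OF k' e s] ek Comp_Zero[OF K s] by simp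
  have "Plus C (d \<cdot> k) (Zero C ?K B) = k"
    using Comp_Plus_left[OF k' d se] d_se sek Comp_Id_left[OF k'] by simp
  then have dk: "d \<cdot> k = k"
    using Plus_commute[OF K B Comp_Hom[OF k' d] Zero_Hom[OF K B]] Zero_Plus[OF K B Comp_Hom[OF k' d]]
    by simp
  \<comment> \<open>\<open>k\<close> is monic and \<open>k q = d\<close>, so the identities
    \<open>q k = 1\<close> and \<open>q s = 0\<close> may be checked for \<open>d\<close>.\<close>
  have qk: "q \<cdot> k = Id C ?K"
    using kernel_cancel[OF k Comp_Hom[OF k' q] Id_Hom[OF K]] Comp_assoc[OF k' q k'] kq dk
      Comp_Id_right[OF k'] by simp
  have "Plus C (d \<cdot> s) s = s"
    using Comp_Plus_left[OF s d se] d_se Comp_assoc[OF s e s] es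
    by (simp add: Comp_Id_left[OF s] Comp_Id_right[OF s])
  then have "d \<cdot> s = Zero C P B"
    using eq_Zero_of_Plus_eq[OF Comp_Hom[OF s d] s] by blast
  then have qs: "q \<cdot> s = Zero C P ?K"
    using kernel_cancel[OF k Comp_Hom[OF s q] Zero_Hom[OF P K]] Comp_assoc[OF s q k'] kq
      Comp_Zero[OF P k'] by simp
  have "Plus C (s \<cdot> e) (k \<cdot> q) = Id C B"
    using Plus_commute[OF B B se d] kq d_se by simp
  then have "is_biproduct C P ?K B s k e q"
    unfolding is_biproduct_def using P K B s k' e q es qk qs ek by simp
  then show ?thesis
    unfolding direct_summand_def by blast
qed

end


section \<open>Representations\<close>

lemma Rep_simps [simp]:
  "Obj (Rep Q C) = reps Q C" "Arr (Rep Q C) = rep_homs Q C"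
  "Dom (Rep Q C) = rdom" "Cod (Rep Q C) = rcod"
  by (simp_all add: Rep_def)

lemma comp_at_Rep [simp]:
  assumes "i \<in> Vert Q"
  shows "comp_at (\<psi> \<cdot>\<^bsub>Rep Q C\<^esub> \<phi>) i = comp_at \<psi> i \<cdot>\<^bsub>C\<^esub> comp_at \<phi> i"
    and "comp_at (Id (Rep Q C) F) i = Id C (at_vert F i)"
    and "comp_at (Plus (Rep Q C) \<phi> \<psi>) i = Plus C (comp_at \<phi> i) (comp_at \<psi> i)"
    and "comp_at (Zero (Rep Q C) F G) i = Zero C (at_vert F i) (at_vert G i)"
  using assms by (simp_all add: Rep_def)

text \<open>\<open>restrict\<close> supplies the extensionality that \<open>reps\<close> requires,
  so constructions may work with arbitrary functions on vertices and arrows.\<close>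

definition mk_rep :: "('v, 'a) quiver \<Rightarrow> ('v \<Rightarrow> 'o) \<Rightarrow> ('a \<Rightarrow> 'm) \<Rightarrow> ('v, 'a, 'o, 'm) rep" where
  "mk_rep Q A a = \<lparr>at_vert = restrict A (Vert Q), at_arrow = restrict a (Arrow Q)\<rparr>"

definition mk_rep_hom :: "('v, 'a) quiver \<Rightarrow> ('v, 'a, 'o, 'm) rep \<Rightarrow> ('v, 'a, 'o, 'm) rep \<Rightarrow>
    ('v \<Rightarrow> 'm) \<Rightarrow> ('v, 'a, 'o, 'm) rep_hom" where
  "mk_rep_hom Q F G h = \<lparr>rdom = F, rcod = G, comp_at = restrict h (Vert Q)\<rparr>"

lemma comp_at_mk_rep_hom [simp]: "i \<in> Vert Q \<Longrightarrow> comp_at (mk_rep_hom Q F G h) i = h i"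
  by (simp add: mk_rep_hom_def)

lemma mk_rep_simps [simp]:
  "i \<in> Vert Q \<Longrightarrow> at_vert (mk_rep Q A a) i = A i"
  "\<alpha> \<in> Arrow Q \<Longrightarrow> at_arrow (mk_rep Q A a) \<alpha> = a \<alpha>"
  by (simp_all add: mk_rep_def)

lemma
  assumes "\<phi> \<in> Hom (Rep Q C) F G"
  shows Rep_Hom_reps: "F \<in> reps Q C" "G \<in> reps Q C"
    and Rep_Hom_comp_at: "i \<in> Vert Q \<Longrightarrow> comp_at \<phi> i \<in> Hom C (at_vert F i) (at_vert G i)"
    and Rep_Hom_natural: "\<alpha> \<in> Arrow Q \<Longrightarrow>
      comp_at \<phi> (tgt Q \<alpha>) \<cdot>\<^bsub>C\<^esub> at_arrow F \<alpha> = at_arrow G \<alpha> \<cdot>\<^bsub>C\<^esub> comp_at \<phi> (src Q \<alpha>)"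
  using assms by (auto simp: Hom_def[of "Rep Q C"] rep_homs_def)

lemma Rep_Hom_eqI:
  assumes "\<phi> \<in> Hom (Rep Q C) F G" and "\<psi> \<in> Hom (Rep Q C) F G"
    and "\<And>i. i \<in> Vert Q \<Longrightarrow> comp_at \<phi> i = comp_at \<psi> i"
  shows "\<phi> = \<psi>"
proof -
  have "comp_at \<phi> \<in> extensional (Vert Q)" "comp_at \<psi> \<in> extensional (Vert Q)"
    using assms(1,2) by (auto simp: Hom_def[of "Rep Q C"] rep_homs_def PiE_def)
  then have "comp_at \<phi> = comp_at \<psi>"
    using assms(3) by (rule extensionalityI)
  then show ?thesis
    using assms(1,2) by (simp add: Hom_def[of "Rep Q C"])
qed

locale quiver_representations = quiver Q + abelian_category C
  for Q :: "('v, 'a) quiver" and C :: "('o, 'm) cat" (structure)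
begin

lemma at_vert_Obj: "\<lbrakk>F \<in> reps Q C; i \<in> Vert Q\<rbrakk> \<Longrightarrow> at_vert F i \<in> Obj C"
  by (auto simp: reps_def)

lemma at_arrow_Hom: "\<lbrakk>F \<in> reps Q C; \<alpha> \<in> Arrow Q\<rbrakk>
    \<Longrightarrow> at_arrow F \<alpha> \<in> Hom C (at_vert F (src Q \<alpha>)) (at_vert F (tgt Q \<alpha>))"
  by (auto simp: reps_def)

lemma mk_rep_in_reps:
  assumes "\<And>i. i \<in> Vert Q \<Longrightarrow> A i \<in> Obj C"
    and "\<And>\<alpha>. \<alpha> \<in> Arrow Q \<Longrightarrow> a \<alpha> \<in> Hom C (A (src Q \<alpha>)) (A (tgt Q \<alpha>))"
  shows "mk_rep Q A a \<in> reps Q C"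
  using assms src_Vert tgt_Vert by (auto simp: reps_def mk_rep_def)

lemma mk_rep_hom_Hom:
  assumes "F \<in> reps Q C" and "G \<in> reps Q C"
    and "\<And>i. i \<in> Vert Q \<Longrightarrow> h i \<in> Hom C (at_vert F i) (at_vert G i)"
    and "\<And>\<alpha>. \<alpha> \<in> Arrow Q \<Longrightarrow> h (tgt Q \<alpha>) \<cdot> at_arrow F \<alpha> = at_arrow G \<alpha> \<cdot> h (src Q \<alpha>)"
  shows "mk_rep_hom Q F G h \<in> Hom (Rep Q C) F G"
  using assms src_Vert tgt_Vert by (auto simp: Hom_def[of "Rep Q C"] rep_homs_def mk_rep_hom_def)

section \<open>Representations as a preadditive category\<close>

lemma Rep_category: "category (Rep Q C)"
proof
  show Id: "Id (Rep Q C) F \<in> Hom (Rep Q C) F F" if "F \<in> Obj (Rep Q C)" for F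
  proof -
    have "mk_rep_hom Q F F (\<lambda>i. Id C (at_vert F i)) \<in> Hom (Rep Q C) F F"
      using that at_vert_Obj Id_Hom at_arrow_Hom Comp_Id_left Comp_Id_right
      by (intro mk_rep_hom_Hom) (simp_all, metis)
    then show ?thesis
      by (simp add: mk_rep_hom_def Rep_def)
  qed
  show Comp: "\<psi> \<cdot>\<^bsub>Rep Q C\<^esub> \<phi> \<in> Hom (Rep Q C) F H"
    if \<phi>: "\<phi> \<in> Hom (Rep Q C) F G" and \<psi>: "\<psi> \<in> Hom (Rep Q C) G H" for F G H \<phi> \<psi>
  proof -
    have "mk_rep_hom Q F H (\<lambda>i. comp_at \<psi> i \<cdot> comp_at \<phi> i) \<in> Hom (Rep Q C) F H"
    proof (rule mk_rep_hom_Hom)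
      fix \<alpha>
      assume \<alpha>: "\<alpha> \<in> Arrow Q"
      note F = at_arrow_Hom[OF Rep_Hom_reps(1)[OF \<phi>] \<alpha>]
        and G = at_arrow_Hom[OF Rep_Hom_reps(2)[OF \<phi>] \<alpha>]
        and H = at_arrow_Hom[OF Rep_Hom_reps(2)[OF \<psi>] \<alpha>]
        and \<phi>s = Rep_Hom_comp_at[OF \<phi> src_Vert[OF \<alpha>]]
        and \<phi>t = Rep_Hom_comp_at[OF \<phi> tgt_Vert[OF \<alpha>]]
        and \<psi>s = Rep_Hom_comp_at[OF \<psi> src_Vert[OF \<alpha>]]
        and \<psi>t = Rep_Hom_comp_at[OF \<psi> tgt_Vert[OF \<alpha>]]
      show "(comp_at \<psi> (tgt Q \<alpha>) \<cdot> comp_at \<phi> (tgt Q \<alpha>)) \<cdot> at_arrow F \<alpha>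
        = at_arrow H \<alpha> \<cdot> comp_at \<psi> (src Q \<alpha>) \<cdot> comp_at \<phi> (src Q \<alpha>)"
        using Comp_assoc[OF F \<phi>t \<psi>t] Comp_assoc[OF \<phi>s G \<psi>t] Comp_assoc[OF \<phi>s \<psi>s H]
          Rep_Hom_natural[OF \<phi> \<alpha>] Rep_Hom_natural[OF \<psi> \<alpha>] by simp
    qed (use Rep_Hom_reps[OF \<phi>] Rep_Hom_reps[OF \<psi>] Rep_Hom_comp_at[OF \<phi>] Rep_Hom_comp_at[OF \<psi>]
        in \<open>auto intro: Comp_Hom\<close>)
    moreover have "rdom \<phi> = F" "rcod \<psi> = H"
      using \<phi> \<psi> by (simp_all add: Hom_def[of "Rep Q C"])
    ultimately show ?thesis
      by (simp add: mk_rep_hom_def Rep_def)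
  qed
  show "(\<chi> \<cdot>\<^bsub>Rep Q C\<^esub> \<psi>) \<cdot>\<^bsub>Rep Q C\<^esub> \<phi> = \<chi> \<cdot>\<^bsub>Rep Q C\<^esub> (\<psi> \<cdot>\<^bsub>Rep Q C\<^esub> \<phi>)"
    if \<phi>: "\<phi> \<in> Hom (Rep Q C) E F" and \<psi>: "\<psi> \<in> Hom (Rep Q C) F G" and \<chi>: "\<chi> \<in> Hom (Rep Q C) G H"
    for E F G H \<phi> \<psi> \<chi>
    by (rule Rep_Hom_eqI[OF Comp[OF \<phi> Comp[OF \<psi> \<chi>]] Comp[OF Comp[OF \<phi> \<psi>] \<chi>]])
      (simp add: Comp_assoc[OF Rep_Hom_comp_at[OF \<phi>] Rep_Hom_comp_at[OF \<psi>] Rep_Hom_comp_at[OF \<chi>]])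
  show "\<phi> \<cdot>\<^bsub>Rep Q C\<^esub> Id (Rep Q C) F = \<phi>" if \<phi>: "\<phi> \<in> Hom (Rep Q C) F G" for F G \<phi>
    using Rep_Hom_reps[OF \<phi>]
    by (intro Rep_Hom_eqI[OF Comp[OF Id \<phi>] \<phi>]) (simp_all add: Comp_Id_right[OF Rep_Hom_comp_at[OF \<phi>]])
  show "Id (Rep Q C) G \<cdot>\<^bsub>Rep Q C\<^esub> \<phi> = \<phi>" if \<phi>: "\<phi> \<in> Hom (Rep Q C) F G" for F G \<phi>
    using Rep_Hom_reps[OF \<phi>]
    by (intro Rep_Hom_eqI[OF Comp[OF \<phi> Id] \<phi>]) (simp_all add: Comp_Id_left[OF Rep_Hom_comp_at[OF \<phi>]])
qed (auto simp: rep_homs_def)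

sublocale Rep: category "Rep Q C"
  by (rule Rep_category)

lemma Rep_Zero_Hom:
  assumes F: "F \<in> reps Q C" and G: "G \<in> reps Q C"
  shows "Zero (Rep Q C) F G \<in> Hom (Rep Q C) F G"
proof -
  have "mk_rep_hom Q F G (\<lambda>i. Zero C (at_vert F i) (at_vert G i)) \<in> Hom (Rep Q C) F G"
  proof (rule mk_rep_hom_Hom[OF F G])
    fix \<alpha>
    assume "\<alpha> \<in> Arrow Q"
    then show "Zero C (at_vert F (tgt Q \<alpha>)) (at_vert G (tgt Q \<alpha>)) \<cdot> at_arrow F \<alpha>
      = at_arrow G \<alpha> \<cdot> Zero C (at_vert F (src Q \<alpha>)) (at_vert G (src Q \<alpha>))"
      using Zero_Comp[OF at_vert_Obj[OF G] at_arrow_Hom[OF F]]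
        Comp_Zero[OF at_vert_Obj[OF F] at_arrow_Hom[OF G]] src_Vert tgt_Vert by simp
  qed (simp add: Zero_Hom at_vert_Obj F G)
  then show ?thesis
    by (simp add: mk_rep_hom_def Rep_def)
qed

lemma Rep_Plus_Hom:
  assumes \<phi>: "\<phi> \<in> Hom (Rep Q C) F G" and \<psi>: "\<psi> \<in> Hom (Rep Q C) F G"
  shows "Plus (Rep Q C) \<phi> \<psi> \<in> Hom (Rep Q C) F G"
proof -
  note F = Rep_Hom_reps(1)[OF \<phi>] and G = Rep_Hom_reps(2)[OF \<phi>]
  have "mk_rep_hom Q F G (\<lambda>i. Plus C (comp_at \<phi> i) (comp_at \<psi> i)) \<in> Hom (Rep Q C) F G"
  proof (rule mk_rep_hom_Hom[OF F G])
    fix \<alpha>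
    assume \<alpha>: "\<alpha> \<in> Arrow Q"
    show "Plus C (comp_at \<phi> (tgt Q \<alpha>)) (comp_at \<psi> (tgt Q \<alpha>)) \<cdot> at_arrow F \<alpha>
      = at_arrow G \<alpha> \<cdot> Plus C (comp_at \<phi> (src Q \<alpha>)) (comp_at \<psi> (src Q \<alpha>))"
      using \<alpha> Comp_Plus_left[OF at_arrow_Hom[OF F \<alpha>] Rep_Hom_comp_at[OF \<phi> tgt_Vert[OF \<alpha>]]
          Rep_Hom_comp_at[OF \<psi> tgt_Vert[OF \<alpha>]]]
        Comp_Plus_right[OF Rep_Hom_comp_at[OF \<phi> src_Vert[OF \<alpha>]]
          Rep_Hom_comp_at[OF \<psi> src_Vert[OF \<alpha>]] at_arrow_Hom[OF G \<alpha>]]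
      by (simp add: Rep_Hom_natural[OF \<phi>] Rep_Hom_natural[OF \<psi>])
  qed (simp add: Plus_Hom at_vert_Obj F G Rep_Hom_comp_at[OF \<phi>] Rep_Hom_comp_at[OF \<psi>])
  moreover have "rdom \<phi> = F" "rcod \<phi> = G"
    using \<phi> by (simp_all add: Hom_def[of "Rep Q C"])
  ultimately show ?thesis
    by (simp add: mk_rep_hom_def Rep_def)
qed

text \<open>Negatives are chosen vertex by vertex, so their naturality needs proof: both legs of a
  square are additive inverses of the same arrow, because \<phi> itself is natural, and such
  inverses are unique.\<close>

lemma Rep_ex_neg:
  assumes \<phi>: "\<phi> \<in> Hom (Rep Q C) F G"
  shows "\<exists>\<psi> \<in> Hom (Rep Q C) F G. Plus (Rep Q C) \<psi> \<phi> = Zero (Rep Q C) F G"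
proof -
  note F = Rep_Hom_reps(1)[OF \<phi>] and G = Rep_Hom_reps(2)[OF \<phi>]
  have "\<exists>w \<in> Hom C (at_vert F i) (at_vert G i).
      Plus C w (comp_at \<phi> i) = Zero C (at_vert F i) (at_vert G i)" if "i \<in> Vert Q" for i
    using that by (intro ex_diff Zero_Hom at_vert_Obj F G Rep_Hom_comp_at[OF \<phi>])
  then obtain w where w: "\<And>i. i \<in> Vert Q \<Longrightarrow> w i \<in> Hom C (at_vert F i) (at_vert G i)"
    and w\<phi>: "\<And>i. i \<in> Vert Q \<Longrightarrow> Plus C (w i) (comp_at \<phi> i) = Zero C (at_vert F i) (at_vert G i)"
    by metis
  have \<psi>: "mk_rep_hom Q F G w \<in> Hom (Rep Q C) F G"
  proof (rule mk_rep_hom_Hom[OF F G w])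
    fix \<alpha>
    assume \<alpha>: "\<alpha> \<in> Arrow Q"
    note s = src_Vert[OF \<alpha>] and t = tgt_Vert[OF \<alpha>]
    note F\<alpha> = at_arrow_Hom[OF F \<alpha>] and G\<alpha> = at_arrow_Hom[OF G \<alpha>]
    have "Plus C (w (tgt Q \<alpha>) \<cdot> at_arrow F \<alpha>) (comp_at \<phi> (tgt Q \<alpha>) \<cdot> at_arrow F \<alpha>)
        = Zero C (at_vert F (src Q \<alpha>)) (at_vert G (tgt Q \<alpha>))"
      using Comp_Plus_left[OF F\<alpha> w[OF t] Rep_Hom_comp_at[OF \<phi> t]] w\<phi>[OF t]
        Zero_Comp[OF at_vert_Obj[OF G t] F\<alpha>] by simp
    moreover have "Plus C (at_arrow G \<alpha> \<cdot> w (src Q \<alpha>)) (at_arrow G \<alpha> \<cdot> comp_at \<phi> (src Q \<alpha>))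
        = Zero C (at_vert F (src Q \<alpha>)) (at_vert G (tgt Q \<alpha>))"
      using Comp_Plus_right[OF w[OF s] Rep_Hom_comp_at[OF \<phi> s] G\<alpha>] w\<phi>[OF s]
        Comp_Zero[OF at_vert_Obj[OF F s] G\<alpha>] by simp
    ultimately show "w (tgt Q \<alpha>) \<cdot> at_arrow F \<alpha> = at_arrow G \<alpha> \<cdot> w (src Q \<alpha>)"
      using Rep_Hom_natural[OF \<phi> \<alpha>]
      by (intro Plus_right_cancel[OF at_vert_Obj[OF F s] at_vert_Obj[OF G t]
            Comp_Hom[OF F\<alpha> w[OF t]] Comp_Hom[OF w[OF s] G\<alpha>]
            Comp_Hom[OF Rep_Hom_comp_at[OF \<phi> s] G\<alpha>]]) simp
  qed
  have "Plus (Rep Q C) (mk_rep_hom Q F G w) \<phi> = Zero (Rep Q C) F G"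
    by (rule Rep_Hom_eqI[OF Rep_Plus_Hom[OF \<psi> \<phi>] Rep_Zero_Hom[OF F G]]) (simp add: w\<phi>)
  then show ?thesis
    using \<psi> by blast
qed

sublocale Rep: preadditive_category "Rep Q C"
proof (intro preadditive_category.intro preadditive_category_axioms.intro Rep_category)
  fix F G
  assume "F \<in> Obj (Rep Q C)" and "G \<in> Obj (Rep Q C)"
  then have F: "F \<in> reps Q C" and G: "G \<in> reps Q C"
    by simp_all
  show "comm_group (Defs.hom_group (Rep Q C) F G)"
  proof (rule comm_groupI; simp only: Defs.hom_group_def partial_object.simps monoid.simps)
    fix \<phi> \<psi> \<chi>
    assume \<phi>: "\<phi> \<in> Hom (Rep Q C) F G" and \<psi>: "\<psi> \<in> Hom (Rep Q C) F G" and \<chi>: "\<chi> \<in> Hom (Rep Q C) F G"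
    show "Plus (Rep Q C) (Plus (Rep Q C) \<phi> \<psi>) \<chi> = Plus (Rep Q C) \<phi> (Plus (Rep Q C) \<psi> \<chi>)"
      by (rule Rep_Hom_eqI[OF Rep_Plus_Hom[OF Rep_Plus_Hom[OF \<phi> \<psi>] \<chi>] Rep_Plus_Hom[OF \<phi> Rep_Plus_Hom[OF \<psi> \<chi>]]])
        (simp add: Plus_assoc[OF at_vert_Obj[OF F] at_vert_Obj[OF G] Rep_Hom_comp_at[OF \<phi>]
            Rep_Hom_comp_at[OF \<psi>] Rep_Hom_comp_at[OF \<chi>]])
  next
    fix \<phi> \<psi>
    assume \<phi>: "\<phi> \<in> Hom (Rep Q C) F G" and \<psi>: "\<psi> \<in> Hom (Rep Q C) F G"
    show "Plus (Rep Q C) \<phi> \<psi> = Plus (Rep Q C) \<psi> \<phi>"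
      by (rule Rep_Hom_eqI[OF Rep_Plus_Hom[OF \<phi> \<psi>] Rep_Plus_Hom[OF \<psi> \<phi>]])
        (simp add: Plus_commute[OF at_vert_Obj[OF F] at_vert_Obj[OF G] Rep_Hom_comp_at[OF \<phi>] Rep_Hom_comp_at[OF \<psi>]])
  next
    fix \<phi>
    assume \<phi>: "\<phi> \<in> Hom (Rep Q C) F G"
    show "Plus (Rep Q C) (Zero (Rep Q C) F G) \<phi> = \<phi>"
      by (rule Rep_Hom_eqI[OF Rep_Plus_Hom[OF Rep_Zero_Hom[OF F G] \<phi>] \<phi>])
        (simp add: Zero_Plus[OF at_vert_Obj[OF F] at_vert_Obj[OF G] Rep_Hom_comp_at[OF \<phi>]])
  qed (auto intro: Rep_Plus_Hom Rep_Zero_Hom F G Rep_ex_neg)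
next
  fix \<phi> \<phi>' \<psi> F G H
  assume \<phi>: "\<phi> \<in> Hom (Rep Q C) F G" and \<phi>': "\<phi>' \<in> Hom (Rep Q C) F G" and \<psi>: "\<psi> \<in> Hom (Rep Q C) G H"
  show "\<psi> \<cdot>\<^bsub>Rep Q C\<^esub> Plus (Rep Q C) \<phi> \<phi>' = Plus (Rep Q C) (\<psi> \<cdot>\<^bsub>Rep Q C\<^esub> \<phi>) (\<psi> \<cdot>\<^bsub>Rep Q C\<^esub> \<phi>')"
    by (rule Rep_Hom_eqI[OF Rep.Comp_Hom[OF Rep_Plus_Hom[OF \<phi> \<phi>'] \<psi>]
          Rep_Plus_Hom[OF Rep.Comp_Hom[OF \<phi> \<psi>] Rep.Comp_Hom[OF \<phi>' \<psi>]]])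
      (simp add: Comp_Plus_right[OF Rep_Hom_comp_at[OF \<phi>] Rep_Hom_comp_at[OF \<phi>'] Rep_Hom_comp_at[OF \<psi>]])
next
  fix \<phi> \<psi> \<psi>' F G H
  assume \<phi>: "\<phi> \<in> Hom (Rep Q C) F G" and \<psi>: "\<psi> \<in> Hom (Rep Q C) G H" and \<psi>': "\<psi>' \<in> Hom (Rep Q C) G H"
  show "Plus (Rep Q C) \<psi> \<psi>' \<cdot>\<^bsub>Rep Q C\<^esub> \<phi> = Plus (Rep Q C) (\<psi> \<cdot>\<^bsub>Rep Q C\<^esub> \<phi>) (\<psi>' \<cdot>\<^bsub>Rep Q C\<^esub> \<phi>)"
    by (rule Rep_Hom_eqI[OF Rep.Comp_Hom[OF \<phi> Rep_Plus_Hom[OF \<psi> \<psi>']]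
          Rep_Plus_Hom[OF Rep.Comp_Hom[OF \<phi> \<psi>] Rep.Comp_Hom[OF \<phi> \<psi>']]])
      (simp add: Comp_Plus_left[OF Rep_Hom_comp_at[OF \<phi>] Rep_Hom_comp_at[OF \<psi>] Rep_Hom_comp_at[OF \<psi>']])
qed

section \<open>Epimorphisms, cokernels, kernels and coproducts at the vertices\<close>

lemma Rep_epiI:
  assumes e: "e \<in> Hom (Rep Q C) F G" and epi: "\<And>i. i \<in> Vert Q \<Longrightarrow> epi_arr C (comp_at e i)"
  shows "epi_arr (Rep Q C) e"
proof (rule Rep.epiI[OF e])
  fix H \<phi> \<psi>
  assume \<phi>: "\<phi> \<in> Hom (Rep Q C) G H" and \<psi>: "\<psi> \<in> Hom (Rep Q C) G H"
    and eq: "\<phi> \<cdot>\<^bsub>Rep Q C\<^esub> e = \<psi> \<cdot>\<^bsub>Rep Q C\<^esub> e"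
  show "\<phi> = \<psi>"
  proof (rule Rep_Hom_eqI[OF \<phi> \<psi>])
    fix i
    assume i: "i \<in> Vert Q"
    have "comp_at \<phi> i \<cdot> comp_at e i = comp_at \<psi> i \<cdot> comp_at e i"
      using eq i by (metis comp_at_Rep(1))
    then show "comp_at \<phi> i = comp_at \<psi> i"
      using epi_cancel[OF epi[OF i] Rep_Hom_comp_at[OF e i] Rep_Hom_comp_at[OF \<phi> i] Rep_Hom_comp_at[OF \<psi> i]]
      by blast
  qed
qed

text \<open>The chosen cokernels form a representation because naturality of \<open>e\<close> makes
  each composite of a structure map of \<open>G\<close> with the cokernel at its target kill
  \<open>e\<close> at the source, so that it descends. The conclusion is stated at the vertices,
  where epimorphisms are to be detected.\<close>

lemma Rep_pointwise_cokernel: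
  assumes e: "e \<in> Hom (Rep Q C) F G"
  obtains q H where "q \<in> Hom (Rep Q C) G H"
    and "\<And>i. i \<in> Vert Q \<Longrightarrow> is_cokernel C (comp_at e i) (comp_at q i)"
proof -
  note F = Rep_Hom_reps(1)[OF e] and G = Rep_Hom_reps(2)[OF e]
  have "\<exists>c. is_cokernel C (comp_at e i) c" if "i \<in> Vert Q" for i
    using ex_cokernel Rep_Hom_comp_at[OF e that] by (simp add: Hom_def)
  then obtain c where c: "\<And>i. i \<in> Vert Q \<Longrightarrow> is_cokernel C (comp_at e i) (c i)"
    by metis
  have ends: "Dom C (comp_at e i) = at_vert F i" "Cod C (comp_at e i) = at_vert G i" if "i \<in> Vert Q" for i
    using Rep_Hom_comp_at[OF e that] by (simp_all add: Hom_def)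
  have cH: "c i \<in> Hom C (at_vert G i) (Cod C (c i))" if "i \<in> Vert Q" for i
    using cokernel_Hom[OF c[OF that]] ends[OF that] by simp
  have ce: "c i \<cdot> comp_at e i = Zero C (at_vert F i) (Cod C (c i))" if "i \<in> Vert Q" for i
    using c[OF that] ends[OF that] by (simp add: is_cokernel_def)
  have "\<exists>a. a \<in> Hom C (Cod C (c (src Q \<alpha>))) (Cod C (c (tgt Q \<alpha>))) \<and>
      a \<cdot> c (src Q \<alpha>) = c (tgt Q \<alpha>) \<cdot> at_arrow G \<alpha>" if \<alpha>: "\<alpha> \<in> Arrow Q" for \<alpha>
  proof -
    note s = src_Vert[OF \<alpha>] and t = tgt_Vert[OF \<alpha>]
    note F\<alpha> = at_arrow_Hom[OF F \<alpha>] and G\<alpha> = at_arrow_Hom[OF G \<alpha>]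
    have "(c (tgt Q \<alpha>) \<cdot> at_arrow G \<alpha>) \<cdot> comp_at e (src Q \<alpha>)
        = (c (tgt Q \<alpha>) \<cdot> comp_at e (tgt Q \<alpha>)) \<cdot> at_arrow F \<alpha>"
      using Comp_assoc[OF Rep_Hom_comp_at[OF e s] G\<alpha> cH[OF t]] Rep_Hom_natural[OF e \<alpha>]
        Comp_assoc[OF F\<alpha> Rep_Hom_comp_at[OF e t] cH[OF t]] by simp
    also have "\<dots> = Zero C (at_vert F (src Q \<alpha>)) (Cod C (c (tgt Q \<alpha>)))"
      using ce[OF t] Zero_Comp[OF _ F\<alpha>] Hom_Obj[OF cH[OF t]] by simp
    finally show ?thesis
      using cokernel_desc[OF c[OF s], of "c (tgt Q \<alpha>) \<cdot> at_arrow G \<alpha>"] ends[OF s]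
        Comp_Hom[OF G\<alpha> cH[OF t]] by metis
  qed
  then obtain a where a: "\<And>\<alpha>. \<alpha> \<in> Arrow Q \<Longrightarrow> a \<alpha> \<in> Hom C (Cod C (c (src Q \<alpha>))) (Cod C (c (tgt Q \<alpha>)))"
    and ac: "\<And>\<alpha>. \<alpha> \<in> Arrow Q \<Longrightarrow> a \<alpha> \<cdot> c (src Q \<alpha>) = c (tgt Q \<alpha>) \<cdot> at_arrow G \<alpha>"
    by metis
  define H where "H = mk_rep Q (\<lambda>i. Cod C (c i)) a"
  have H: "H \<in> reps Q C"
    unfolding H_def using a Hom_Obj[OF cH] by (intro mk_rep_in_reps) auto
  have "mk_rep_hom Q G H c \<in> Hom (Rep Q C) G H"
    by (rule mk_rep_hom_Hom[OF G H]) (simp_all add: H_def cH ac src_Vert)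
  then show thesis
    using that c by simp
qed

text \<open>The pointwise cokernel \<open>q\<close> satisfies \<open>q e = 0 = 0 e\<close>, hence
  vanishes; so an arrow whose composite with \<open>e\<close> at \<open>i\<close> is zero factors
  through a zero arrow. This direction is what allows lifting along an epimorphism of
  representations at a single vertex.\<close>

lemma Rep_epiD:
  assumes e: "e \<in> Hom (Rep Q C) F G" and epi: "epi_arr (Rep Q C) e" and i: "i \<in> Vert Q"
  shows "epi_arr C (comp_at e i)"
proof -
  obtain q H where q: "q \<in> Hom (Rep Q C) G H"
    and c: "\<And>i. i \<in> Vert Q \<Longrightarrow> is_cokernel C (comp_at e i) (comp_at q i)"
    using Rep_pointwise_cokernel[OF e] by blast
  note F = Rep_Hom_reps(1)[OF e] and G = Rep_Hom_reps(2)[OF e] and H = Rep_Hom_reps(2)[OF q]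
  note ei = Rep_Hom_comp_at[OF e] and qi = Rep_Hom_comp_at[OF q]
  have ends: "Dom C (comp_at e j) = at_vert F j" "Cod C (comp_at e j) = at_vert G j"
    "Cod C (comp_at q j) = at_vert H j" if "j \<in> Vert Q" for j
    using ei[OF that] qi[OF that] by (simp_all add: Hom_def)
  have "q \<cdot>\<^bsub>Rep Q C\<^esub> e = Zero (Rep Q C) G H \<cdot>\<^bsub>Rep Q C\<^esub> e"
  proof (rule Rep_Hom_eqI[OF Rep.Comp_Hom[OF e q] Rep.Comp_Hom[OF e Rep_Zero_Hom[OF G H]]])
    fix j
    assume j: "j \<in> Vert Q"
    have "comp_at q j \<cdot> comp_at e j = Zero C (at_vert F j) (at_vert H j)"
      using c[OF j] ends[OF j] by (simp add: is_cokernel_def)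
    then show "comp_at (q \<cdot>\<^bsub>Rep Q C\<^esub> e) j = comp_at (Zero (Rep Q C) G H \<cdot>\<^bsub>Rep Q C\<^esub> e) j"
      using j Zero_Comp[OF at_vert_Obj[OF H j] ei[OF j]] by simp
  qed
  then have "q = Zero (Rep Q C) G H"
    using Rep.epi_cancel[OF epi e q Rep_Zero_Hom[OF G H]] by blast
  then have q0: "comp_at q i = Zero C (at_vert G i) (at_vert H i)"
    using i by simp
  show ?thesis
  proof (rule epi_of_Comp_eq_Zero[OF ei[OF i]])
    fix Z d
    assume d: "d \<in> Hom C (at_vert G i) Z" and de: "d \<cdot> comp_at e i = Zero C (at_vert F i) Z"
    obtain u where u: "u \<in> Hom C (at_vert H i) Z" and "u \<cdot> comp_at q i = d"
      using cokernel_desc[OF c[OF i], of d Z] d de ends[OF i] by metis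
    then show "d = Zero C (at_vert G i) Z"
      using Comp_Zero[OF at_vert_Obj[OF G i] u] q0 by simp
  qed
qed

text \<open>Provides the complement when an epimorphism onto a projective representation splits.
  Structure maps and lifts are induced at the vertices; they are compatible because the kernels
  there are monic.\<close>

lemma Rep_ex_kernel:
  assumes \<phi>: "\<phi> \<in> Hom (Rep Q C) F G"
  shows "\<exists>k. is_kernel (Rep Q C) \<phi> k"
proof -
  note F = Rep_Hom_reps(1)[OF \<phi>] and G = Rep_Hom_reps(2)[OF \<phi>]
  have "\<exists>k. is_kernel C (comp_at \<phi> i) k" if "i \<in> Vert Q" for i
    using ex_kernel Rep_Hom_comp_at[OF \<phi> that] by (simp add: Hom_def)
  then obtain k where k: "\<And>i. i \<in> Vert Q \<Longrightarrow> is_kernel C (comp_at \<phi> i) (k i)"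
    by metis
  have ends: "Dom C (comp_at \<phi> i) = at_vert F i" "Cod C (comp_at \<phi> i) = at_vert G i" if "i \<in> Vert Q" for i
    using Rep_Hom_comp_at[OF \<phi> that] by (simp_all add: Hom_def)
  have kH: "k i \<in> Hom C (Dom C (k i)) (at_vert F i)" if "i \<in> Vert Q" for i
    using kernel_Hom[OF k[OF that]] ends[OF that] by simp
  have \<phi>k: "comp_at \<phi> i \<cdot> k i = Zero C (Dom C (k i)) (at_vert G i)" if "i \<in> Vert Q" for i
    using k[OF that] ends[OF that] by (simp add: is_kernel_def)
  have "\<exists>a. a \<in> Hom C (Dom C (k (src Q \<alpha>))) (Dom C (k (tgt Q \<alpha>))) \<and>
      k (tgt Q \<alpha>) \<cdot> a = at_arrow F \<alpha> \<cdot> k (src Q \<alpha>)" if \<alpha>: "\<alpha> \<in> Arrow Q" for \<alpha>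
  proof -
    note s = src_Vert[OF \<alpha>] and t = tgt_Vert[OF \<alpha>]
    note F\<alpha> = at_arrow_Hom[OF F \<alpha>] and G\<alpha> = at_arrow_Hom[OF G \<alpha>]
    have "comp_at \<phi> (tgt Q \<alpha>) \<cdot> (at_arrow F \<alpha> \<cdot> k (src Q \<alpha>))
        = at_arrow G \<alpha> \<cdot> (comp_at \<phi> (src Q \<alpha>) \<cdot> k (src Q \<alpha>))"
      using Comp_assoc[OF kH[OF s] F\<alpha> Rep_Hom_comp_at[OF \<phi> t]] Rep_Hom_natural[OF \<phi> \<alpha>]
        Comp_assoc[OF kH[OF s] Rep_Hom_comp_at[OF \<phi> s] G\<alpha>] by simp
    also have "\<dots> = Zero C (Dom C (k (src Q \<alpha>))) (at_vert G (tgt Q \<alpha>))"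
      using \<phi>k[OF s] Comp_Zero[OF _ G\<alpha>] Hom_Obj[OF kH[OF s]] by simp
    finally show ?thesis
      using kernel_lift[OF k[OF t], of "at_arrow F \<alpha> \<cdot> k (src Q \<alpha>)"] ends[OF t]
        Comp_Hom[OF kH[OF s] F\<alpha>] by metis
  qed
  then obtain a where a: "\<And>\<alpha>. \<alpha> \<in> Arrow Q \<Longrightarrow> a \<alpha> \<in> Hom C (Dom C (k (src Q \<alpha>))) (Dom C (k (tgt Q \<alpha>)))"
    and ka: "\<And>\<alpha>. \<alpha> \<in> Arrow Q \<Longrightarrow> k (tgt Q \<alpha>) \<cdot> a \<alpha> = at_arrow F \<alpha> \<cdot> k (src Q \<alpha>)"
    by metis
  define K where "K = mk_rep Q (\<lambda>i. Dom C (k i)) a"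
  define \<kappa> where "\<kappa> = mk_rep_hom Q K F k"
  have K: "K \<in> reps Q C"
    unfolding K_def using a Hom_Obj[OF kH] by (intro mk_rep_in_reps) auto
  have K_simps: "\<And>i. i \<in> Vert Q \<Longrightarrow> at_vert K i = Dom C (k i)" "\<And>\<alpha>. \<alpha> \<in> Arrow Q \<Longrightarrow> at_arrow K \<alpha> = a \<alpha>"
    by (simp_all add: K_def)
  have \<kappa>: "\<kappa> \<in> Hom (Rep Q C) K F"
    unfolding \<kappa>_def by (rule mk_rep_hom_Hom[OF K F]) (simp_all add: K_simps kH ka tgt_Vert)
  have \<kappa>_at: "comp_at \<kappa> i = k i" if "i \<in> Vert Q" for i
    using that by (simp add: \<kappa>_def)
  have Rep_ends: "rdom \<phi> = F" "rcod \<phi> = G" "rdom \<kappa> = K" "rcod \<kappa> = F" "\<phi> \<in> rep_homs Q C" "\<kappa> \<in> rep_homs Q C"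
    using \<phi> \<kappa> by (simp_all add: Hom_def[of "Rep Q C"])
  have \<phi>\<kappa>: "\<phi> \<cdot>\<^bsub>Rep Q C\<^esub> \<kappa> = Zero (Rep Q C) K G"
    by (rule Rep_Hom_eqI[OF Rep.Comp_Hom[OF \<kappa> \<phi>] Rep_Zero_Hom[OF K G]]) (simp add: \<kappa>_at \<phi>k K_simps)
  have lift: "\<exists>!u. u \<in> Hom (Rep Q C) X K \<and> \<kappa> \<cdot>\<^bsub>Rep Q C\<^esub> u = h"
    if h: "h \<in> Hom (Rep Q C) X F" and \<phi>h: "\<phi> \<cdot>\<^bsub>Rep Q C\<^esub> h = Zero (Rep Q C) X G" for X h
  proof -
    note X = Rep_Hom_reps(1)[OF h] and hi = Rep_Hom_comp_at[OF h]
    have "\<exists>u. u \<in> Hom C (at_vert X i) (Dom C (k i)) \<and> k i \<cdot> u = comp_at h i" if i: "i \<in> Vert Q" for i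
    proof -
      have "comp_at \<phi> i \<cdot> comp_at h i = Zero C (at_vert X i) (at_vert G i)"
        using \<phi>h i by (metis comp_at_Rep(1,4))
      then show ?thesis
        using kernel_lift[OF k[OF i], of "comp_at h i"] ends[OF i] hi[OF i] by metis
    qed
    then obtain u where u: "\<And>i. i \<in> Vert Q \<Longrightarrow> u i \<in> Hom C (at_vert X i) (Dom C (k i))"
      and ku: "\<And>i. i \<in> Vert Q \<Longrightarrow> k i \<cdot> u i = comp_at h i"
      by metis
    have U: "mk_rep_hom Q X K u \<in> Hom (Rep Q C) X K"
    proof (rule mk_rep_hom_Hom[OF X K])
      fix \<alpha>
      assume \<alpha>: "\<alpha> \<in> Arrow Q"
      note s = src_Vert[OF \<alpha>] and t = tgt_Vert[OF \<alpha>]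
      note X\<alpha> = at_arrow_Hom[OF X \<alpha>] and F\<alpha> = at_arrow_Hom[OF F \<alpha>]
      \<comment> \<open>Both sides equal \<open>F_\<alpha>\<close> after \<open>h\<close> at the
        source: the left by naturality of \<open>h\<close>, the right by the choice of
        \<open>a\<close>. Then \<open>k\<close> at the target is cancelled.\<close>
      have "k (tgt Q \<alpha>) \<cdot> (u (tgt Q \<alpha>) \<cdot> at_arrow X \<alpha>) = k (tgt Q \<alpha>) \<cdot> (a \<alpha> \<cdot> u (src Q \<alpha>))"
        using Comp_assoc[OF X\<alpha> u[OF t] kH[OF t]] ku[OF t] Rep_Hom_natural[OF h \<alpha>] ku[OF s]
          Comp_assoc[OF u[OF s] kH[OF s] F\<alpha>] ka[OF \<alpha>] Comp_assoc[OF u[OF s] a[OF \<alpha>] kH[OF t]] by simp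
      then show "u (tgt Q \<alpha>) \<cdot> at_arrow X \<alpha> = at_arrow K \<alpha> \<cdot> u (src Q \<alpha>)"
        using kernel_cancel[OF k[OF t] Comp_Hom[OF X\<alpha> u[OF t]] Comp_Hom[OF u[OF s] a[OF \<alpha>]]]
        by (simp add: K_simps \<alpha>)
    qed (simp add: u K_simps)
    have \<kappa>U: "\<kappa> \<cdot>\<^bsub>Rep Q C\<^esub> mk_rep_hom Q X K u = h"
      by (rule Rep_Hom_eqI[OF Rep.Comp_Hom[OF U \<kappa>] h]) (simp add: \<kappa>_at ku)
    have unique: "v = w"
      if v: "v \<in> Hom (Rep Q C) X K" and w: "w \<in> Hom (Rep Q C) X K"
        and eq: "\<kappa> \<cdot>\<^bsub>Rep Q C\<^esub> v = \<kappa> \<cdot>\<^bsub>Rep Q C\<^esub> w" for v w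
    proof (rule Rep_Hom_eqI[OF v w])
      fix i
      assume i: "i \<in> Vert Q"
      have "k i \<cdot> comp_at v i = k i \<cdot> comp_at w i"
        using eq i \<kappa>_at by (metis comp_at_Rep(1))
      then show "comp_at v i = comp_at w i"
        using kernel_cancel[OF k[OF i]] Rep_Hom_comp_at[OF v i] Rep_Hom_comp_at[OF w i] K_simps(1)[OF i]
        by metis
    qed
    show ?thesis
      using U \<kappa>U unique by (intro ex1I[of _ "mk_rep_hom Q X K u"]) auto
  qed
  have "is_kernel (Rep Q C) \<phi> \<kappa>"
    unfolding is_kernel_def using Rep_ends \<phi>\<kappa> lift by simp
  then show ?thesis
    by blast
qed

text \<open>The size of \<open>I\<close> does not enter: what counts is that the values at each
  single vertex have a coproduct. This is how free representations can be summed over a large set of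
  vertices.\<close>

lemma Rep_ex_coproduct:
  assumes A: "\<And>i. i \<in> I \<Longrightarrow> A i \<in> reps Q C"
    and ex: "\<And>j. j \<in> Vert Q \<Longrightarrow> \<exists>P \<iota>. is_coproduct C I (\<lambda>i. at_vert (A i) j) P \<iota>"
  shows "\<exists>P \<iota>. is_coproduct (Rep Q C) I A P \<iota>"
proof -
  obtain P \<iota> where P: "\<And>j. j \<in> Vert Q \<Longrightarrow> is_coproduct C I (\<lambda>i. at_vert (A i) j) (P j) (\<iota> j)"
    using ex by metis
  have PO: "P j \<in> Obj C" if "j \<in> Vert Q" for j
    using P[OF that] by (simp add: is_coproduct_def)
  have \<iota>: "\<iota> j i \<in> Hom C (at_vert (A i) j) (P j)" if "j \<in> Vert Q" "i \<in> I" for i j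
    using coproduct_Hom[OF P] that by blast
  have "\<exists>a. a \<in> Hom C (P (src Q \<alpha>)) (P (tgt Q \<alpha>)) \<and>
      (\<forall>i \<in> I. a \<cdot> \<iota> (src Q \<alpha>) i = \<iota> (tgt Q \<alpha>) i \<cdot> at_arrow (A i) \<alpha>)" if \<alpha>: "\<alpha> \<in> Arrow Q" for \<alpha>
    using coproduct_desc[OF P[OF src_Vert[OF \<alpha>]] PO[OF tgt_Vert[OF \<alpha>]],
        of "\<lambda>i. \<iota> (tgt Q \<alpha>) i \<cdot> at_arrow (A i) \<alpha>"]
      Comp_Hom[OF at_arrow_Hom[OF A \<alpha>] \<iota>[OF tgt_Vert[OF \<alpha>]]]
    by metis
  then obtain a where a: "\<And>\<alpha>. \<alpha> \<in> Arrow Q \<Longrightarrow> a \<alpha> \<in> Hom C (P (src Q \<alpha>)) (P (tgt Q \<alpha>))"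
    and a\<iota>: "\<And>\<alpha> i. \<lbrakk>\<alpha> \<in> Arrow Q; i \<in> I\<rbrakk>
      \<Longrightarrow> a \<alpha> \<cdot> \<iota> (src Q \<alpha>) i = \<iota> (tgt Q \<alpha>) i \<cdot> at_arrow (A i) \<alpha>"
    by metis
  define R where "R = mk_rep Q P a"
  have R: "R \<in> reps Q C"
    unfolding R_def using a PO by (intro mk_rep_in_reps) auto
  have R_simps: "\<And>i. i \<in> Vert Q \<Longrightarrow> at_vert R i = P i" "\<And>\<alpha>. \<alpha> \<in> Arrow Q \<Longrightarrow> at_arrow R \<alpha> = a \<alpha>"
    by (simp_all add: R_def)
  define \<nu> where "\<nu> i = mk_rep_hom Q (A i) R (\<lambda>j. \<iota> j i)" for i
  have \<nu>: "\<nu> i \<in> Hom (Rep Q C) (A i) R" if "i \<in> I" for i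
    unfolding \<nu>_def using that
    by (intro mk_rep_hom_Hom[OF A R]) (simp_all add: R_simps \<iota> a\<iota>)
  have \<nu>_at: "comp_at (\<nu> i) j = \<iota> j i" if "j \<in> Vert Q" for i j
    using that by (simp add: \<nu>_def)
  have "is_coproduct (Rep Q C) I A R \<nu>"
  proof (rule Rep.coproductI)
    show "R \<in> Obj (Rep Q C)"
      using R by simp
    fix X f
    assume "X \<in> Obj (Rep Q C)" and f: "\<And>i. i \<in> I \<Longrightarrow> f i \<in> Hom (Rep Q C) (A i) X"
    then have X: "X \<in> reps Q C"
      by simp
    have "\<exists>h. h \<in> Hom C (P j) (at_vert X j) \<and> (\<forall>i \<in> I. h \<cdot> \<iota> j i = comp_at (f i) j)"
      if j: "j \<in> Vert Q" for j
      using coproduct_desc[OF P[OF j] at_vert_Obj[OF X j], of "\<lambda>i. comp_at (f i) j"]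
        Rep_Hom_comp_at[OF f j] by metis
    then obtain h where h: "\<And>j. j \<in> Vert Q \<Longrightarrow> h j \<in> Hom C (P j) (at_vert X j)"
      and h\<iota>: "\<And>j i. \<lbrakk>j \<in> Vert Q; i \<in> I\<rbrakk> \<Longrightarrow> h j \<cdot> \<iota> j i = comp_at (f i) j"
      by metis
    have H: "mk_rep_hom Q R X h \<in> Hom (Rep Q C) R X"
    proof (rule mk_rep_hom_Hom[OF R X])
      fix \<alpha>
      assume \<alpha>: "\<alpha> \<in> Arrow Q"
      note s = src_Vert[OF \<alpha>] and t = tgt_Vert[OF \<alpha>]
      note X\<alpha> = at_arrow_Hom[OF X \<alpha>]
      have "h (tgt Q \<alpha>) \<cdot> a \<alpha> = at_arrow X \<alpha> \<cdot> h (src Q \<alpha>)"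
      proof (rule coproduct_ext[OF P[OF s] Comp_Hom[OF a[OF \<alpha>] h[OF t]] Comp_Hom[OF h[OF s] X\<alpha>]])
        fix i
        assume i: "i \<in> I"
        show "(h (tgt Q \<alpha>) \<cdot> a \<alpha>) \<cdot> \<iota> (src Q \<alpha>) i = (at_arrow X \<alpha> \<cdot> h (src Q \<alpha>)) \<cdot> \<iota> (src Q \<alpha>) i"
          using Comp_assoc[OF \<iota>[OF s i] a[OF \<alpha>] h[OF t]] a\<iota>[OF \<alpha> i]
            Comp_assoc[OF at_arrow_Hom[OF A[OF i] \<alpha>] \<iota>[OF t i] h[OF t]] h\<iota>[OF t i]
            Comp_assoc[OF \<iota>[OF s i] h[OF s] X\<alpha>] h\<iota>[OF s i] Rep_Hom_natural[OF f[OF i] \<alpha>] by simp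
      qed
      then show "h (tgt Q \<alpha>) \<cdot> at_arrow R \<alpha> = at_arrow X \<alpha> \<cdot> h (src Q \<alpha>)"
        by (simp add: R_simps \<alpha>)
    qed (simp add: h R_simps)
    have "mk_rep_hom Q R X h \<cdot>\<^bsub>Rep Q C\<^esub> \<nu> i = f i" if i: "i \<in> I" for i
      by (rule Rep_Hom_eqI[OF Rep.Comp_Hom[OF \<nu>[OF i] H] f[OF i]]) (simp add: \<nu>_at h\<iota> i)
    then show "\<exists>h. h \<in> Hom (Rep Q C) R X \<and> (\<forall>i \<in> I. h \<cdot>\<^bsub>Rep Q C\<^esub> \<nu> i = f i)"
      using H by blast
  next
    fix X h k
    assume h: "h \<in> Hom (Rep Q C) R X" and k: "k \<in> Hom (Rep Q C) R X"
      and eq: "\<And>i. i \<in> I \<Longrightarrow> h \<cdot>\<^bsub>Rep Q C\<^esub> \<nu> i = k \<cdot>\<^bsub>Rep Q C\<^esub> \<nu> i"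
    show "h = k"
    proof (rule Rep_Hom_eqI[OF h k])
      fix j
      assume j: "j \<in> Vert Q"
      have "comp_at h j \<cdot> \<iota> j i = comp_at k j \<cdot> \<iota> j i" if "i \<in> I" for i
        using eq[OF that] j \<nu>_at by (metis comp_at_Rep(1))
      then show "comp_at h j = comp_at k j"
        using coproduct_ext[OF P[OF j]] Rep_Hom_comp_at[OF h j] Rep_Hom_comp_at[OF k j] R_simps(1)[OF j]
        by metis
    qed
  qed (rule \<nu>)
  then show ?thesis
    by blast
qed

end


section \<open>The adjunctions of \<open>f\<^sub>i\<close> and \<open>g\<^sub>i\<close> with evaluation at \<open>i\<close>\<close>

text \<open>\<open>push C F u \<rho>\<close> and \<open>pull C F u \<rho>\<close> are \<open>F\<^sub>\<rho> \<circ> u\<close> and \<open>u \<circ> F\<^sub>\<rho>\<close>.\<close>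

definition push :: "('o, 'm) cat \<Rightarrow> ('v, 'a, 'o, 'm) rep \<Rightarrow> 'm \<Rightarrow> 'a list \<Rightarrow> 'm" where
  "push C F = foldl (\<lambda>h \<alpha>. at_arrow F \<alpha> \<cdot>\<^bsub>C\<^esub> h)"

definition pull :: "('o, 'm) cat \<Rightarrow> ('v, 'a, 'o, 'm) rep \<Rightarrow> 'm \<Rightarrow> 'a list \<Rightarrow> 'm" where
  "pull C F u \<rho> = foldr (\<lambda>\<alpha> h. h \<cdot>\<^bsub>C\<^esub> at_arrow F \<alpha>) \<rho> u"

lemma push_simps [simp]:
  "push C F u [] = u" "push C F u (\<rho> @ [\<alpha>]) = at_arrow F \<alpha> \<cdot>\<^bsub>C\<^esub> push C F u \<rho>"
  by (simp_all add: push_def)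

lemma pull_simps [simp]:
  "pull C F u [] = u" "pull C F u (\<alpha> # \<rho>) = pull C F u \<rho> \<cdot>\<^bsub>C\<^esub> at_arrow F \<alpha>"
  by (simp_all add: pull_def)

context quiver
begin

lemma walk_Vert: "walk Q i \<rho> j \<Longrightarrow> i \<in> Vert Q \<and> j \<in> Vert Q"
  by (induction \<rho> arbitrary: i) (auto simp: src_Vert)

text \<open>\<open>walk\<close> consumes a path from its start, but \<open>after_path\<close> and
  \<open>push\<close> extend it at its end. This lets inductions on \<open>push\<close> run from the
  end, while those on \<open>pull\<close> follow the recursion of \<open>walk\<close>.\<close>

lemma walk_snoc: "walk Q i (\<rho> @ [\<alpha>]) k \<longleftrightarrow> walk Q i \<rho> (src Q \<alpha>) \<and> \<alpha> \<in> Arrow Q \<and> tgt Q \<alpha> = k"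
  by (induction \<rho> arbitrary: i) (auto simp: src_Vert tgt_Vert)

lemma trivial_path: "i \<in> Vert Q \<Longrightarrow> (i, []) \<in> paths Q i i"
  by (simp add: paths_def)

lemma after_path_paths:
  "\<lbrakk>\<alpha> \<in> Arrow Q; \<rho> \<in> paths Q i (src Q \<alpha>)\<rbrakk> \<Longrightarrow> after_path \<alpha> \<rho> \<in> paths Q i (tgt Q \<alpha>)"
  by (auto simp: paths_def after_path_def walk_snoc)

lemma before_path_paths:
  "\<lbrakk>\<alpha> \<in> Arrow Q; \<rho> \<in> paths Q (tgt Q \<alpha>) i\<rbrakk> \<Longrightarrow> before_path Q \<rho> \<alpha> \<in> paths Q (src Q \<alpha>) i"
  by (auto simp: paths_def before_path_def)

text \<open>Paths carry their starting vertex, so \<open>fst\<close> sorts the paths ending at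
  \<open>j\<close>; the resulting sets become the fibres in
  \<open>coproduct_iterated\<close>.\<close>

lemma paths_to_fst: "i \<in> Vert Q \<Longrightarrow> {\<rho> \<in> paths_to Q j. fst \<rho> = i} = paths Q i j"
  by (auto simp: paths_to_def paths_def)

end

context quiver_representations
begin

lemma push_Hom:
  assumes F: "F \<in> reps Q C" and u: "u \<in> Hom C X (at_vert F i)"
  shows "walk Q i \<rho> j \<Longrightarrow> push C F u \<rho> \<in> Hom C X (at_vert F j)"
proof (induction \<rho> arbitrary: j rule: rev_induct)
  case (snoc \<alpha> \<rho>)
  then show ?case
    using Comp_Hom[OF _ at_arrow_Hom[OF F]] by (auto simp: walk_snoc)
qed (use u in simp)

text \<open>The naturality squares of the arrows of a path, pasted together.\<close>

lemma push_natural: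
  assumes \<phi>: "\<phi> \<in> Hom (Rep Q C) F G" and u: "u \<in> Hom C X (at_vert F i)"
  shows "walk Q i \<rho> j \<Longrightarrow> comp_at \<phi> j \<cdot> push C F u \<rho> = push C G (comp_at \<phi> i \<cdot> u) \<rho>"
proof (induction \<rho> arbitrary: j rule: rev_induct)
  case (snoc \<alpha> \<rho>)
  note F = Rep_Hom_reps(1)[OF \<phi>] and G = Rep_Hom_reps(2)[OF \<phi>]
  have w: "walk Q i \<rho> (src Q \<alpha>)" and \<alpha>: "\<alpha> \<in> Arrow Q" and j: "j = tgt Q \<alpha>"
    using snoc.prems by (auto simp: walk_snoc)
  note p = push_Hom[OF F u w]
  show ?case
    using Comp_assoc[OF p at_arrow_Hom[OF F \<alpha>] Rep_Hom_comp_at[OF \<phi> tgt_Vert[OF \<alpha>]]]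
      Comp_assoc[OF p Rep_Hom_comp_at[OF \<phi> src_Vert[OF \<alpha>]] at_arrow_Hom[OF G \<alpha>]]
      Rep_Hom_natural[OF \<phi> \<alpha>] snoc.IH[OF w] j by simp
qed simp

lemma pull_Hom:
  assumes F: "F \<in> reps Q C" and u: "u \<in> Hom C (at_vert F i) X"
  shows "walk Q j \<rho> i \<Longrightarrow> pull C F u \<rho> \<in> Hom C (at_vert F j) X"
proof (induction \<rho> arbitrary: j)
  case (Cons \<alpha> \<rho>)
  then show ?case
    using Comp_Hom[OF at_arrow_Hom[OF F]] by auto
qed (use u in simp)

end

section \<open>The free representations f_i(X), their projectivity and the epimorphisms out of their
  coproducts\<close>

locale quiver_representations_copowers = quiver_representations +
  assumes ex_copower: "\<lbrakk>i \<in> Vert Q; j \<in> Vert Q; X \<in> Obj C\<rbrakk>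
    \<Longrightarrow> \<exists>P \<mu>. is_coproduct C (paths Q i j) (\<lambda>_. X) P \<mu>"
begin

lemma f_vert_coproduct:
  assumes "i \<in> Vert Q" and "j \<in> Vert Q" and "X \<in> Obj C"
  shows "is_coproduct C (paths Q i j) (\<lambda>_. X) (f_vert Q C i X j) (incl Q C i X j)"
proof -
  have "\<exists>P. case P of (P, \<mu>) \<Rightarrow> is_coproduct C (paths Q i j) (\<lambda>_. X) P \<mu>"
    using ex_copower[OF assms] by simp
  then have "case copower_obj C (paths Q i j) X of (P, \<mu>) \<Rightarrow> is_coproduct C (paths Q i j) (\<lambda>_. X) P \<mu>"
    unfolding copower_obj_def by (rule someI_ex)
  then show ?thesis
    by (simp add: f_vert_def incl_def case_prod_unfold)
qed

lemma f_obj_at_vert: "j \<in> Vert Q \<Longrightarrow> at_vert (f_obj Q C i X) j = f_vert Q C i X j"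
  by (simp add: f_obj_def)

text \<open>The definite description in \<open>f_obj\<close> denotes: extending paths by \<alpha>
  gives a family of inclusions at the target, and the coproduct at the source induces exactly one
  arrow from it.\<close>

lemma
  assumes i: "i \<in> Vert Q" and X: "X \<in> Obj C" and \<alpha>: "\<alpha> \<in> Arrow Q"
  shows f_obj_at_arrow_Hom:
      "at_arrow (f_obj Q C i X) \<alpha> \<in> Hom C (f_vert Q C i X (src Q \<alpha>)) (f_vert Q C i X (tgt Q \<alpha>))"
    and f_obj_at_arrow_incl: "\<rho> \<in> paths Q i (src Q \<alpha>) \<Longrightarrow>
      at_arrow (f_obj Q C i X) \<alpha> \<cdot> incl Q C i X (src Q \<alpha>) \<rho> = incl Q C i X (tgt Q \<alpha>) (after_path \<alpha> \<rho>)"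
proof -
  note s = f_vert_coproduct[OF i src_Vert[OF \<alpha>] X] and t = f_vert_coproduct[OF i tgt_Vert[OF \<alpha>] X]
  have "\<exists>!h. h \<in> Hom C (f_vert Q C i X (src Q \<alpha>)) (f_vert Q C i X (tgt Q \<alpha>)) \<and>
       (\<forall>\<rho> \<in> paths Q i (src Q \<alpha>).
          h \<cdot> incl Q C i X (src Q \<alpha>) \<rho> = incl Q C i X (tgt Q \<alpha>) (after_path \<alpha> \<rho>))"
    using s t after_path_paths[OF \<alpha>] by (simp add: is_coproduct_def)
  from theI'[OF this]
  show "at_arrow (f_obj Q C i X) \<alpha> \<in> Hom C (f_vert Q C i X (src Q \<alpha>)) (f_vert Q C i X (tgt Q \<alpha>))"
    and "\<rho> \<in> paths Q i (src Q \<alpha>) \<Longrightarrow>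
      at_arrow (f_obj Q C i X) \<alpha> \<cdot> incl Q C i X (src Q \<alpha>) \<rho> = incl Q C i X (tgt Q \<alpha>) (after_path \<alpha> \<rho>)"
    using \<alpha> by (simp_all add: f_obj_def)
qed

lemma f_obj_reps: "\<lbrakk>i \<in> Vert Q; X \<in> Obj C\<rbrakk> \<Longrightarrow> f_obj Q C i X \<in> reps Q C"
  using f_vert_coproduct f_obj_at_arrow_Hom src_Vert tgt_Vert
  by (auto simp: reps_def f_obj_def is_coproduct_def)

lemma incl_Hom:
  "\<lbrakk>i \<in> Vert Q; X \<in> Obj C; walk Q i \<rho> j\<rbrakk> \<Longrightarrow> incl Q C i X j (i, \<rho>) \<in> Hom C X (f_vert Q C i X j)"
  using coproduct_Hom[OF f_vert_coproduct[of i j X], of "(i, \<rho>)"] walk_Vert[of i \<rho> j]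
  by (simp add: paths_def)

text \<open>Each arrow of the quiver carries the inclusion of a path to that of the extended path,
  so the trivial path generates all of f_i(X). This is the Yoneda argument that determines the
  arrows out of f_i(X).\<close>

lemma push_incl:
  assumes i: "i \<in> Vert Q" and X: "X \<in> Obj C"
  shows "walk Q i \<rho> j \<Longrightarrow> push C (f_obj Q C i X) (incl Q C i X i (i, [])) \<rho> = incl Q C i X j (i, \<rho>)"
proof (induction \<rho> arbitrary: j rule: rev_induct)
  case (snoc \<alpha> \<rho>)
  have w: "walk Q i \<rho> (src Q \<alpha>)" and \<alpha>: "\<alpha> \<in> Arrow Q" and j: "j = tgt Q \<alpha>"
    using snoc.prems by (auto simp: walk_snoc)
  then show ?case
    using f_obj_at_arrow_incl[OF i X \<alpha>, of "(i, \<rho>)"] snoc.IH[OF w]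
    by (simp add: paths_def after_path_def)
qed simp

lemma f_obj_Hom_incl:
  assumes i: "i \<in> Vert Q" and X: "X \<in> Obj C" and \<phi>: "\<phi> \<in> Hom (Rep Q C) (f_obj Q C i X) F"
    and w: "walk Q i \<rho> j"
  shows "comp_at \<phi> j \<cdot> incl Q C i X j (i, \<rho>) = push C F (comp_at \<phi> i \<cdot> incl Q C i X i (i, [])) \<rho>"
  using push_natural[OF \<phi> _ w, of "incl Q C i X i (i, [])" X] incl_Hom[OF i X, of "[]" i]
    push_incl[OF i X w] i
  by (simp add: f_obj_at_vert)

text \<open>Uniqueness half of the adjunction, whose unit is the inclusion of the trivial path; the
  inclusions of the other paths are handled by \<open>f_obj_Hom_incl\<close>.\<close>

lemma f_obj_Hom_ext:
  assumes i: "i \<in> Vert Q" and X: "X \<in> Obj C"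
    and \<phi>: "\<phi> \<in> Hom (Rep Q C) (f_obj Q C i X) F" and \<psi>: "\<psi> \<in> Hom (Rep Q C) (f_obj Q C i X) F"
    and eq: "comp_at \<phi> i \<cdot> incl Q C i X i (i, []) = comp_at \<psi> i \<cdot> incl Q C i X i (i, [])"
  shows "\<phi> = \<psi>"
proof (rule Rep_Hom_eqI[OF \<phi> \<psi>])
  fix j
  assume j: "j \<in> Vert Q"
  have \<phi>j: "comp_at \<phi> j \<in> Hom C (f_vert Q C i X j) (at_vert F j)"
    and \<psi>j: "comp_at \<psi> j \<in> Hom C (f_vert Q C i X j) (at_vert F j)"
    using Rep_Hom_comp_at[OF \<phi> j] Rep_Hom_comp_at[OF \<psi> j] j by (simp_all add: f_obj_at_vert)
  show "comp_at \<phi> j = comp_at \<psi> j"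
  proof (rule coproduct_ext[OF f_vert_coproduct[OF i j X] \<phi>j \<psi>j])
    fix \<rho>
    assume "\<rho> \<in> paths Q i j"
    then show "comp_at \<phi> j \<cdot> incl Q C i X j \<rho> = comp_at \<psi> j \<cdot> incl Q C i X j \<rho>"
      using f_obj_Hom_incl[OF i X \<phi>] f_obj_Hom_incl[OF i X \<psi>] eq by (auto simp: paths_def)
  qed
qed

text \<open>Existence half of the adjunction: the component at \<open>j\<close> is induced by the
  family \<open>F_\<rho> u\<close>, which \<open>push\<close> computes. It is natural since both
  sides of a square send the copy at \<rho> to \<open>u\<close> pushed along the extended
  path.\<close>

lemma f_obj_transpose:
  assumes i: "i \<in> Vert Q" and X: "X \<in> Obj C" and F: "F \<in> reps Q C" and u: "u \<in> Hom C X (at_vert F i)"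
  obtains \<phi> where "\<phi> \<in> Hom (Rep Q C) (f_obj Q C i X) F" and "comp_at \<phi> i \<cdot> incl Q C i X i (i, []) = u"
proof -
  have "\<exists>h. h \<in> Hom C (f_vert Q C i X j) (at_vert F j) \<and>
      (\<forall>\<rho> \<in> paths Q i j. h \<cdot> incl Q C i X j \<rho> = push C F u (snd \<rho>))" if j: "j \<in> Vert Q" for j
  proof -
    have "push C F u (snd \<rho>) \<in> Hom C X (at_vert F j)" if "\<rho> \<in> paths Q i j" for \<rho>
      using push_Hom[OF F u] that by (auto simp: paths_def)
    then show ?thesis
      using coproduct_desc[OF f_vert_coproduct[OF i j X] at_vert_Obj[OF F j],
          of "\<lambda>\<rho>. push C F u (snd \<rho>)"] by metis
  qed
  then obtain h where h: "\<And>j. j \<in> Vert Q \<Longrightarrow> h j \<in> Hom C (f_vert Q C i X j) (at_vert F j)"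
    and h_incl: "\<And>j \<rho>. \<lbrakk>j \<in> Vert Q; \<rho> \<in> paths Q i j\<rbrakk> \<Longrightarrow> h j \<cdot> incl Q C i X j \<rho> = push C F u (snd \<rho>)"
    by metis
  let ?f = "f_obj Q C i X"
  have "mk_rep_hom Q ?f F h \<in> Hom (Rep Q C) ?f F"
  proof (rule mk_rep_hom_Hom[OF f_obj_reps[OF i X] F])
    fix \<alpha>
    assume \<alpha>: "\<alpha> \<in> Arrow Q"
    note s = src_Vert[OF \<alpha>] and t = tgt_Vert[OF \<alpha>]
    note f\<alpha> = f_obj_at_arrow_Hom[OF i X \<alpha>] and F\<alpha> = at_arrow_Hom[OF F \<alpha>]
    show "h (tgt Q \<alpha>) \<cdot> at_arrow ?f \<alpha> = at_arrow F \<alpha> \<cdot> h (src Q \<alpha>)"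
    proof (rule coproduct_ext[OF f_vert_coproduct[OF i s X] Comp_Hom[OF f\<alpha> h[OF t]] Comp_Hom[OF h[OF s] F\<alpha>]])
      fix \<rho>
      assume \<rho>: "\<rho> \<in> paths Q i (src Q \<alpha>)"
      note in\<rho> = coproduct_Hom[OF f_vert_coproduct[OF i s X] \<rho>]
      show "(h (tgt Q \<alpha>) \<cdot> at_arrow ?f \<alpha>) \<cdot> incl Q C i X (src Q \<alpha>) \<rho>
        = (at_arrow F \<alpha> \<cdot> h (src Q \<alpha>)) \<cdot> incl Q C i X (src Q \<alpha>) \<rho>"
        using Comp_assoc[OF in\<rho> f\<alpha> h[OF t]] Comp_assoc[OF in\<rho> h[OF s] F\<alpha>] h_incl[OF s \<rho>]
          f_obj_at_arrow_incl[OF i X \<alpha> \<rho>] h_incl[OF t after_path_paths[OF \<alpha> \<rho>]]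
        by (simp add: after_path_def)
    qed
  qed (simp add: h f_obj_at_vert)
  then show thesis
    using that h_incl[OF i trivial_path[OF i]] i by simp
qed

text \<open>A left adjoint preserves projectives when its right adjoint preserves epimorphisms; for
  evaluation at \<open>i\<close> that is \<open>Rep_epiD\<close>. The lift found at \<open>i\<close>
  is transposed back, and it is correct because it is so on the unit.\<close>

lemma projective_f_obj:
  assumes i: "i \<in> Vert Q" and P: "projective C P"
  shows "projective (Rep Q C) (f_obj Q C i P)"
  unfolding projective_def
proof (intro conjI allI ballI impI)
  have PO: "P \<in> Obj C"
    using P by (simp add: projective_def)
  show "f_obj Q C i P \<in> Obj (Rep Q C)"
    using f_obj_reps[OF i PO] by simp
  fix F G e \<phi>
  assume e: "e \<in> Hom (Rep Q C) F G" and \<phi>: "\<phi> \<in> Hom (Rep Q C) (f_obj Q C i P) G"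
    and epi: "epi_arr (Rep Q C) e"
  note ei = Rep_Hom_comp_at[OF e i]
  have inP: "incl Q C i P i (i, []) \<in> Hom C P (f_vert Q C i P i)"
    using incl_Hom[OF i PO, of "[]" i] i by simp
  have "comp_at \<phi> i \<cdot> incl Q C i P i (i, []) \<in> Hom C P (at_vert G i)"
    using Comp_Hom[OF inP] Rep_Hom_comp_at[OF \<phi> i] i by (simp add: f_obj_at_vert)
  then obtain v where v: "v \<in> Hom C P (at_vert F i)"
    and ev: "comp_at e i \<cdot> v = comp_at \<phi> i \<cdot> incl Q C i P i (i, [])"
    using projective_lift[OF P ei Rep_epiD[OF e epi i]] by blast
  obtain \<psi> where \<psi>: "\<psi> \<in> Hom (Rep Q C) (f_obj Q C i P) F" and \<psi>v: "comp_at \<psi> i \<cdot> incl Q C i P i (i, []) = v"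
    using f_obj_transpose[OF i PO Rep_Hom_reps(1)[OF e] v] .
  have "comp_at \<psi> i \<in> Hom C (f_vert Q C i P i) (at_vert F i)"
    using Rep_Hom_comp_at[OF \<psi> i] i by (simp add: f_obj_at_vert)
  then have "comp_at (e \<cdot>\<^bsub>Rep Q C\<^esub> \<psi>) i \<cdot> incl Q C i P i (i, []) = comp_at \<phi> i \<cdot> incl Q C i P i (i, [])"
    using Comp_assoc[OF inP _ ei, of "comp_at \<psi> i"] \<psi>v ev i by simp
  then have "e \<cdot>\<^bsub>Rep Q C\<^esub> \<psi> = \<phi>"
    by (rule f_obj_Hom_ext[OF i PO Rep.Comp_Hom[OF \<psi> e] \<phi>])
  then show "\<exists>h \<in> Hom (Rep Q C) (f_obj Q C i P) F. e \<cdot>\<^bsub>Rep Q C\<^esub> h = \<phi>"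
    using \<psi> by blast
qed

lemma Coprod_le_f_star_Proj:
  fixes r :: "'k rel"
  shows "Coprod_le (Rep Q C) r (f_star Q C (Proj C)) \<subseteq> Proj (Rep Q C)"
proof
  fix B
  assume "B \<in> Coprod_le (Rep Q C) r (f_star Q C (Proj C))"
  then obtain I :: "'k set" and A \<iota> where A: "\<forall>i \<in> I. A i \<in> f_star Q C (Proj C)"
    and B: "is_coproduct (Rep Q C) I A B \<iota>"
    by (auto simp: Coprod_le_def)
  have "projective (Rep Q C) (A i)" if "i \<in> I" for i
    using A that projective_f_obj by (fastforce simp: f_star_def Proj_def)
  then show "B \<in> Proj (Rep Q C)"
    using Rep.projective_coproduct[OF B] by (simp add: Proj_def)
qed

lemma Add_le_f_star_Proj: "Add_le (Rep Q C) r (f_star Q C (Proj C)) \<subseteq> Proj (Rep Q C)"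
  using Coprod_le_f_star_Proj Rep.projective_direct_summand
  by (fastforce simp: Add_le_def Proj_def)

text \<open>At a vertex \<open>j\<close> of the support, the \<open>j\<close>-th summand already maps onto \<open>F\<^sub>j\<close> through the
  inclusion of the trivial path; elsewhere there is nothing to cover.\<close>

lemma coproduct_f_obj_epi:
  assumes F: "F \<in> reps Q C"
    and V: "\<And>i. i \<in> Supp Q C F \<Longrightarrow> u i \<in> Hom C (V i) (at_vert F i) \<and> epi_arr C (u i)"
    and P: "is_coproduct (Rep Q C) (Supp Q C F) (\<lambda>i. f_obj Q C i (V i)) P \<iota>"
  obtains e where "e \<in> Hom (Rep Q C) P F" and "epi_arr (Rep Q C) e"
proof -
  have Supp: "i \<in> Vert Q" if "i \<in> Supp Q C F" for i
    using that by (simp add: Supp_def)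
  have VO: "V i \<in> Obj C" if "i \<in> Supp Q C F" for i
    using V[OF that] Hom_Obj by blast
  have "\<exists>\<phi>. \<phi> \<in> Hom (Rep Q C) (f_obj Q C i (V i)) F \<and> comp_at \<phi> i \<cdot> incl Q C i (V i) i (i, []) = u i"
    if "i \<in> Supp Q C F" for i
    using f_obj_transpose[OF Supp[OF that] VO[OF that] F conjunct1[OF V[OF that]]] by metis
  then obtain \<phi> where \<phi>: "\<And>i. i \<in> Supp Q C F \<Longrightarrow> \<phi> i \<in> Hom (Rep Q C) (f_obj Q C i (V i)) F"
    and \<phi>u: "\<And>i. i \<in> Supp Q C F \<Longrightarrow> comp_at (\<phi> i) i \<cdot> incl Q C i (V i) i (i, []) = u i"
    by metis
  obtain e where e: "e \<in> Hom (Rep Q C) P F" and e\<iota>: "\<And>i. i \<in> Supp Q C F \<Longrightarrow> e \<cdot>\<^bsub>Rep Q C\<^esub> \<iota> i = \<phi> i"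
    using Rep.coproduct_desc[OF P, of F \<phi>] F \<phi> by auto
  have "epi_arr (Rep Q C) e"
  proof (rule Rep_epiI[OF e])
    fix j
    assume j: "j \<in> Vert Q"
    note ej = Rep_Hom_comp_at[OF e j]
    show "epi_arr C (comp_at e j)"
    proof (cases "j \<in> Supp Q C F")
      case True
      have \<iota>j: "comp_at (\<iota> j) j \<in> Hom C (f_vert Q C j (V j) j) (at_vert P j)"
        using Rep_Hom_comp_at[OF Rep.coproduct_Hom[OF P True] j] j by (simp add: f_obj_at_vert)
      have in_j: "incl Q C j (V j) j (j, []) \<in> Hom C (V j) (f_vert Q C j (V j) j)"
        using incl_Hom[OF j VO[OF True], of "[]" j] j by simp
      have "comp_at e j \<cdot> (comp_at (\<iota> j) j \<cdot> incl Q C j (V j) j (j, [])) = u j"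
        using Comp_assoc[OF in_j \<iota>j ej] \<phi>u[OF True] comp_at_Rep(1)[OF j, of C e "\<iota> j"] e\<iota>[OF True]
        by simp
      then show ?thesis
        using epi_of_epi_Comp[OF Comp_Hom[OF in_j \<iota>j] ej] V[OF True] by simp
    next
      case False
      then show ?thesis
        using epi_to_zero_obj ej j by (simp add: Supp_def)
    qed
  qed
  then show thesis
    using that e by blast
qed

lemma projective_direct_summand_of_epi:
  assumes P: "projective (Rep Q C) P" and e: "e \<in> Hom (Rep Q C) B P" and epi: "epi_arr (Rep Q C) e"
  shows "direct_summand (Rep Q C) P B"
proof -
  have "P \<in> Obj (Rep Q C)"
    using P by (simp add: projective_def)
  then obtain s where "s \<in> Hom (Rep Q C) P B" "e \<cdot>\<^bsub>Rep Q C\<^esub> s = Id (Rep Q C) P"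
    using Rep.projective_lift[OF P e epi Rep.Id_Hom] by blast
  then show ?thesis
    using Rep.split_epi_direct_summand[OF e] Rep_ex_kernel[OF e] by blast
qed

end

locale quiver_representations_coproducts = quiver_representations_copowers +
  assumes ex_coproduct_paths_to:
    "\<lbrakk>j \<in> Vert Q; K \<subseteq> paths_to Q j; \<And>\<rho>. \<rho> \<in> K \<Longrightarrow> B \<rho> \<in> Obj C\<rbrakk> \<Longrightarrow> \<exists>P \<mu>. is_coproduct C K B P \<mu>"
begin

lemma ex_coproduct_f_obj:
  assumes I: "I \<subseteq> Vert Q" and V: "\<And>i. i \<in> I \<Longrightarrow> V i \<in> Obj C"
  shows "\<exists>P \<iota>. is_coproduct (Rep Q C) I (\<lambda>i. f_obj Q C i (V i)) P \<iota>"
proof (rule Rep_ex_coproduct)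
  show "f_obj Q C i (V i) \<in> reps Q C" if "i \<in> I" for i
    using that I V f_obj_reps by blast
  fix j
  assume j: "j \<in> Vert Q"
  \<comment> \<open>Every path into \<open>j\<close> that starts in \<open>I\<close> contributes one
    copy of \<open>V\<close> at its start. The fibre of \<open>fst\<close> over \<open>i\<close> is
    \<open>paths Q i j\<close>, whose coproduct is the value of f_i(V_i) at
    \<open>j\<close>.\<close>
  let ?K = "{\<rho> \<in> paths_to Q j. fst \<rho> \<in> I}"
  obtain P \<mu> where P: "is_coproduct C ?K (\<lambda>\<rho>. V (fst \<rho>)) P \<mu>"
    using ex_coproduct_paths_to[OF j, of ?K "\<lambda>\<rho>. V (fst \<rho>)"] V by auto
  have A: "is_coproduct C {\<rho> \<in> ?K. fst \<rho> = i} (\<lambda>\<rho>. V (fst \<rho>)) (at_vert (f_obj Q C i (V i)) j) (incl Q C i (V i) j)"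
    if i: "i \<in> I" for i
  proof -
    have "{\<rho> \<in> ?K. fst \<rho> = i} = paths Q i j"
      using paths_to_fst[of i j] i I by (auto simp: paths_def)
    \<comment> \<open>On this fibre \<open>V (fst \<rho>)\<close> is constantly \<open>V i\<close>,
      as \<open>f_vert\<close> has it.\<close>
    moreover have "is_coproduct C (paths Q i j) (\<lambda>\<rho>. V (fst \<rho>)) (f_vert Q C i (V i) j) (incl Q C i (V i) j)
        \<longleftrightarrow> is_coproduct C (paths Q i j) (\<lambda>_. V i) (f_vert Q C i (V i) j) (incl Q C i (V i) j)"
      unfolding is_coproduct_def by (auto simp: paths_def)
    ultimately show ?thesis
      using f_vert_coproduct[OF _ j V[OF i]] i I f_obj_at_vert[OF j] by auto
  qed
  show "\<exists>P \<iota>. is_coproduct C I (\<lambda>i. at_vert (f_obj Q C i (V i)) j) P \<iota>"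
    by (rule exI[of _ P], rule coproduct_iterated[where s = fst, OF _ A P]) simp_all
qed

lemma ex_coproduct_f_obj_epi:
  assumes F: "F \<in> reps Q C"
    and V: "\<And>i. i \<in> Supp Q C F \<Longrightarrow> u i \<in> Hom C (V i) (at_vert F i) \<and> epi_arr C (u i)"
  shows "\<exists>P \<iota> e. is_coproduct (Rep Q C) (Supp Q C F) (\<lambda>i. f_obj Q C i (V i)) P \<iota> \<and>
    e \<in> Hom (Rep Q C) P F \<and> epi_arr (Rep Q C) e"
proof -
  have "Supp Q C F \<subseteq> Vert Q" and "\<And>i. i \<in> Supp Q C F \<Longrightarrow> V i \<in> Obj C"
    using V Hom_Obj by (auto simp: Supp_def)
  then obtain P \<iota> where "is_coproduct (Rep Q C) (Supp Q C F) (\<lambda>i. f_obj Q C i (V i)) P \<iota>"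
    using ex_coproduct_f_obj[of "Supp Q C F" V] by blast
  then show ?thesis
    using coproduct_f_obj_epi[OF F V] by metis
qed

text \<open>\<open>Coprod_le\<close> takes index sets from the type of its cardinal, which for
  \<open>|Vert Q|\<close> is the type of vertices; so the support serves as index set as it
  stands.\<close>

lemma coproduct_f_obj_Coprod_le:
  assumes "is_coproduct (Rep Q C) (Supp Q C F) (\<lambda>i. f_obj Q C i (V i)) P \<iota>"
    and "\<And>i. i \<in> Supp Q C F \<Longrightarrow> V i \<in> U"
  shows "P \<in> Coprod_le (Rep Q C) |Vert Q| (f_star Q C U)"
proof -
  have "Supp Q C F \<subseteq> Vert Q"
    by (auto simp: Supp_def)
  then have "|Supp Q C F| \<le>o |Vert Q|" "\<forall>i \<in> Supp Q C F. f_obj Q C i (V i) \<in> f_star Q C U"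
    using assms(2) by (auto simp: f_star_def intro: card_of_mono1)
  then show ?thesis
    unfolding Coprod_le_def by (intro CollectI exI conjI) (rule assms(1) | assumption)+
qed

lemma generating_epi:
  assumes U: "generating C U" and F: "F \<in> reps Q C"
  shows "\<exists>V P \<iota> e. (\<forall>i \<in> Supp Q C F. V i \<in> U) \<and>
    is_coproduct (Rep Q C) (Supp Q C F) (\<lambda>i. f_obj Q C i (V i)) P \<iota> \<and>
    e \<in> Hom (Rep Q C) P F \<and> epi_arr (Rep Q C) e"
proof -
  have "\<exists>A u. A \<in> U \<and> u \<in> Hom C A (at_vert F i) \<and> epi_arr C u" if "i \<in> Supp Q C F" for i
    using U that at_vert_Obj[OF F, of i] unfolding generating_def Supp_def by blast
  then obtain V u where V: "\<And>i. i \<in> Supp Q C F \<Longrightarrow> V i \<in> U"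
    and u: "\<And>i. i \<in> Supp Q C F \<Longrightarrow> u i \<in> Hom C (V i) (at_vert F i) \<and> epi_arr C (u i)"
    by metis
  show ?thesis
    using ex_coproduct_f_obj_epi[of F u V, OF F u] V by blast
qed

lemma generating_Rep:
  assumes U: "generating C U"
  shows "generating (Rep Q C) (Coprod_le (Rep Q C) |Vert Q| (f_star Q C U))"
  unfolding generating_def
proof (intro conjI ballI)
  show "Coprod_le (Rep Q C) |Vert Q| (f_star Q C U) \<subseteq> Obj (Rep Q C)"
    by (auto simp: Coprod_le_def is_coproduct_def)
  fix F
  assume "F \<in> Obj (Rep Q C)"
  then show "\<exists>A \<in> Coprod_le (Rep Q C) |Vert Q| (f_star Q C U). \<exists>e \<in> Hom (Rep Q C) A F. epi_arr (Rep Q C) e"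
    using generating_epi[OF U, of F] coproduct_f_obj_Coprod_le[of F _ _ _ U] by auto
qed

text \<open>Common core of the upper bounds for the projectives: the free representations on the
  covering objects have a coproduct that maps onto \<open>P\<close>, and this epimorphism splits.
  Covers are asked of projective \<open>P\<close> alone, so that they may be built from the
  projectivity of \<open>P\<close>.\<close>

lemma Proj_Rep_le_Add_le:
  assumes "\<And>P. projective (Rep Q C) P \<Longrightarrow> \<exists>V u. \<forall>i \<in> Supp Q C P.
    V i \<in> U \<and> u i \<in> Hom C (V i) (at_vert P i) \<and> epi_arr C (u i)"
  shows "Proj (Rep Q C) \<subseteq> Add_le (Rep Q C) |Vert Q| (f_star Q C U)"
proof
  fix P
  assume "P \<in> Proj (Rep Q C)"
  then have P: "projective (Rep Q C) P" and PR: "P \<in> reps Q C"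
    by (simp_all add: Proj_def projective_def)
  obtain V u where V: "\<And>i. i \<in> Supp Q C P \<Longrightarrow> V i \<in> U"
    and u: "\<And>i. i \<in> Supp Q C P \<Longrightarrow> u i \<in> Hom C (V i) (at_vert P i) \<and> epi_arr C (u i)"
    using assms[OF P] by blast
  obtain B \<iota> e where B: "is_coproduct (Rep Q C) (Supp Q C P) (\<lambda>i. f_obj Q C i (V i)) B \<iota>"
    and e: "e \<in> Hom (Rep Q C) B P" "epi_arr (Rep Q C) e"
    using ex_coproduct_f_obj_epi[of P u V, OF PR u] by blast
  show "P \<in> Add_le (Rep Q C) |Vert Q| (f_star Q C U)"
    unfolding Add_le_def
    using coproduct_f_obj_Coprod_le[OF B V] projective_direct_summand_of_epi[OF P e] by blast
qed

lemma Proj_Rep_le_Add_le_generating: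
  assumes U: "generating C U"
  shows "Proj (Rep Q C) \<subseteq> Add_le (Rep Q C) |Vert Q| (f_star Q C U)"
proof (rule Proj_Rep_le_Add_le)
  fix P
  assume "projective (Rep Q C) P"
  then have "P \<in> reps Q C"
    by (simp add: projective_def)
  then have "\<forall>i \<in> Supp Q C P. \<exists>A u. A \<in> U \<and> u \<in> Hom C A (at_vert P i) \<and> epi_arr C u"
    using U at_vert_Obj unfolding generating_def Supp_def by blast
  then show "\<exists>V u. \<forall>i \<in> Supp Q C P. V i \<in> U \<and> u i \<in> Hom C (V i) (at_vert P i) \<and> epi_arr C (u i)"
    by metis
qed

end

section \<open>The cofree representations g_i(X) and the values of projective
  representations\<close>

locale quiver_representations_powers = quiver_representations +
  assumes ex_power: "\<lbrakk>i \<in> Vert Q; j \<in> Vert Q; X \<in> Obj C\<rbrakk>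
    \<Longrightarrow> \<exists>P \<pi>. is_product C (paths Q j i) (\<lambda>_. X) P \<pi>"
begin

lemma g_vert_product:
  assumes "i \<in> Vert Q" and "j \<in> Vert Q" and "X \<in> Obj C"
  shows "is_product C (paths Q j i) (\<lambda>_. X) (g_vert Q C i X j) (proj Q C i X j)"
proof -
  have "\<exists>P. case P of (P, \<pi>) \<Rightarrow> is_product C (paths Q j i) (\<lambda>_. X) P \<pi>"
    using ex_power[OF assms] by simp
  then have "case power_obj C (paths Q j i) X of (P, \<pi>) \<Rightarrow> is_product C (paths Q j i) (\<lambda>_. X) P \<pi>"
    unfolding power_obj_def by (rule someI_ex)
  then show ?thesis
    by (simp add: g_vert_def proj_def case_prod_unfold)
qed

lemma g_obj_at_vert: "j \<in> Vert Q \<Longrightarrow> at_vert (g_obj Q C i X) j = g_vert Q C i X j"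
  by (simp add: g_obj_def)

lemma proj_Hom:
  "\<lbrakk>i \<in> Vert Q; j \<in> Vert Q; X \<in> Obj C; \<rho> \<in> paths Q j i\<rbrakk> \<Longrightarrow> proj Q C i X j \<rho> \<in> Hom C (g_vert Q C i X j) X"
  using g_vert_product by (simp add: is_product_def)

lemma
  assumes i: "i \<in> Vert Q" and X: "X \<in> Obj C" and \<alpha>: "\<alpha> \<in> Arrow Q"
  shows g_obj_at_arrow_Hom:
      "at_arrow (g_obj Q C i X) \<alpha> \<in> Hom C (g_vert Q C i X (src Q \<alpha>)) (g_vert Q C i X (tgt Q \<alpha>))"
    and g_obj_at_arrow_proj: "\<rho> \<in> paths Q (tgt Q \<alpha>) i \<Longrightarrow>
      proj Q C i X (tgt Q \<alpha>) \<rho> \<cdot> at_arrow (g_obj Q C i X) \<alpha> = proj Q C i X (src Q \<alpha>) (before_path Q \<rho> \<alpha>)"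
proof -
  note s = g_vert_product[OF i src_Vert[OF \<alpha>] X] and t = g_vert_product[OF i tgt_Vert[OF \<alpha>] X]
  have "\<exists>!h. h \<in> Hom C (g_vert Q C i X (src Q \<alpha>)) (g_vert Q C i X (tgt Q \<alpha>)) \<and>
       (\<forall>\<rho> \<in> paths Q (tgt Q \<alpha>) i.
          proj Q C i X (tgt Q \<alpha>) \<rho> \<cdot> h = proj Q C i X (src Q \<alpha>) (before_path Q \<rho> \<alpha>))"
    using s t before_path_paths[OF \<alpha>] by (simp add: is_product_def)
  from theI'[OF this]
  show "at_arrow (g_obj Q C i X) \<alpha> \<in> Hom C (g_vert Q C i X (src Q \<alpha>)) (g_vert Q C i X (tgt Q \<alpha>))"
    and "\<rho> \<in> paths Q (tgt Q \<alpha>) i \<Longrightarrow>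
      proj Q C i X (tgt Q \<alpha>) \<rho> \<cdot> at_arrow (g_obj Q C i X) \<alpha> = proj Q C i X (src Q \<alpha>) (before_path Q \<rho> \<alpha>)"
    using \<alpha> by (simp_all add: g_obj_def)
qed

lemma g_obj_reps: "\<lbrakk>i \<in> Vert Q; X \<in> Obj C\<rbrakk> \<Longrightarrow> g_obj Q C i X \<in> reps Q C"
  using g_vert_product g_obj_at_arrow_Hom src_Vert tgt_Vert
  by (auto simp: reps_def g_obj_def is_product_def)

text \<open>Shows that the description in \<open>g_arr\<close> denotes. The case of the trivial path
  is what carries a lift along g_i(e) back to a lift along \<open>e\<close>.\<close>

lemma g_arr_proj:
  assumes i: "i \<in> Vert Q" and j: "j \<in> Vert Q" and u: "u \<in> Hom C X Y" and \<rho>: "\<rho> \<in> paths Q j i"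
  shows "proj Q C i Y j \<rho> \<cdot> comp_at (g_arr Q C i u) j = u \<cdot> proj Q C i X j \<rho>"
proof -
  have ends: "Dom C u = X" "Cod C u = Y" and X: "X \<in> Obj C" and Y: "Y \<in> Obj C"
    using u Hom_Obj[OF u] by (simp_all add: Hom_def)
  have "\<forall>\<rho> \<in> paths Q j i. u \<cdot> proj Q C i X j \<rho> \<in> Hom C (g_vert Q C i X j) Y"
    using Comp_Hom[OF proj_Hom[OF i j X] u] by blast
  then have "\<exists>!h. h \<in> Hom C (g_vert Q C i X j) (g_vert Q C i Y j) \<and>
      (\<forall>\<rho> \<in> paths Q j i. proj Q C i Y j \<rho> \<cdot> h = u \<cdot> proj Q C i X j \<rho>)"
    using g_vert_product[OF i j X] g_vert_product[OF i j Y] by (simp add: is_product_def)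
  from theI'[OF this] show ?thesis
    using j \<rho> ends by (simp add: g_arr_def)
qed

text \<open>Dual to \<open>f_obj_transpose\<close>: the coordinate of \<phi> at a path \<rho> from
  \<open>j\<close> to \<open>i\<close> is \<open>u\<close> after \<open>F_\<rho>\<close>. Paths grow
  at their start here, so the square for \<alpha> compares \<rho> with
  \<open>before_path Q \<rho> \<alpha>\<close>.\<close>

lemma g_obj_transpose:
  assumes i: "i \<in> Vert Q" and X: "X \<in> Obj C" and F: "F \<in> reps Q C" and u: "u \<in> Hom C (at_vert F i) X"
  obtains \<phi> where "\<phi> \<in> Hom (Rep Q C) F (g_obj Q C i X)" and "proj Q C i X i (i, []) \<cdot> comp_at \<phi> i = u"
proof -
  have "\<exists>h. h \<in> Hom C (at_vert F j) (g_vert Q C i X j) \<and>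
      (\<forall>\<rho> \<in> paths Q j i. proj Q C i X j \<rho> \<cdot> h = pull C F u (snd \<rho>))" if j: "j \<in> Vert Q" for j
  proof -
    have "pull C F u (snd \<rho>) \<in> Hom C (at_vert F j) X" if "\<rho> \<in> paths Q j i" for \<rho>
      using pull_Hom[OF F u] that by (auto simp: paths_def)
    then show ?thesis
      using product_lift[OF g_vert_product[OF i j X] at_vert_Obj[OF F j],
          of "\<lambda>\<rho>. pull C F u (snd \<rho>)"] by metis
  qed
  then obtain h where h: "\<And>j. j \<in> Vert Q \<Longrightarrow> h j \<in> Hom C (at_vert F j) (g_vert Q C i X j)"
    and proj_h: "\<And>j \<rho>. \<lbrakk>j \<in> Vert Q; \<rho> \<in> paths Q j i\<rbrakk> \<Longrightarrow> proj Q C i X j \<rho> \<cdot> h j = pull C F u (snd \<rho>)"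
    by metis
  let ?g = "g_obj Q C i X"
  have "mk_rep_hom Q F ?g h \<in> Hom (Rep Q C) F ?g"
  proof (rule mk_rep_hom_Hom[OF F g_obj_reps[OF i X]])
    fix \<alpha>
    assume \<alpha>: "\<alpha> \<in> Arrow Q"
    note s = src_Vert[OF \<alpha>] and t = tgt_Vert[OF \<alpha>]
    note g\<alpha> = g_obj_at_arrow_Hom[OF i X \<alpha>] and F\<alpha> = at_arrow_Hom[OF F \<alpha>]
    show "h (tgt Q \<alpha>) \<cdot> at_arrow F \<alpha> = at_arrow ?g \<alpha> \<cdot> h (src Q \<alpha>)"
    proof (rule product_ext[OF g_vert_product[OF i t X] Comp_Hom[OF F\<alpha> h[OF t]] Comp_Hom[OF h[OF s] g\<alpha>]])
      fix \<rho>
      assume \<rho>: "\<rho> \<in> paths Q (tgt Q \<alpha>) i"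
      note pr\<rho> = proj_Hom[OF i t X \<rho>]
      show "proj Q C i X (tgt Q \<alpha>) \<rho> \<cdot> (h (tgt Q \<alpha>) \<cdot> at_arrow F \<alpha>)
        = proj Q C i X (tgt Q \<alpha>) \<rho> \<cdot> (at_arrow ?g \<alpha> \<cdot> h (src Q \<alpha>))"
        using Comp_assoc[OF F\<alpha> h[OF t] pr\<rho>] Comp_assoc[OF h[OF s] g\<alpha> pr\<rho>] proj_h[OF t \<rho>]
          g_obj_at_arrow_proj[OF i X \<alpha> \<rho>] proj_h[OF s before_path_paths[OF \<alpha> \<rho>]]
        by (simp add: before_path_def)
    qed
  qed (simp add: h g_obj_at_vert)
  then show thesis
    using that proj_h[OF i trivial_path[OF i]] i by simp
qed

text \<open>Evaluation at \<open>i\<close> is left adjoint to \<open>g\<^sub>i\<close>, hence preserves projectives as soon as \<open>g\<^sub>i\<close>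
  preserves epimorphisms.\<close>

lemma projective_at_vert:
  assumes i: "i \<in> Vert Q" and exact: "exact_functor C (Rep Q C) (g_obj Q C i) (g_arr Q C i)"
    and P: "projective (Rep Q C) P"
  shows "projective C (at_vert P i)"
  unfolding projective_def
proof (intro conjI allI ballI impI)
  have PR: "P \<in> reps Q C"
    using P by (simp add: projective_def)
  show "at_vert P i \<in> Obj C"
    by (rule at_vert_Obj[OF PR i])
  fix X Y e f
  assume e: "e \<in> Hom C X Y" and f: "f \<in> Hom C (at_vert P i) Y" and epi: "epi_arr C e"
  have X: "X \<in> Obj C" and Y: "Y \<in> Obj C"
    using Hom_Obj[OF e] by auto
  \<comment> \<open>Exactness is phrased through short exact sequences, so \<open>e\<close> is
    completed by its kernel; g_i(e) is then a cokernel and hence an epimorphism.\<close>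
  obtain k where "is_kernel C e k"
    using ex_kernel e by (auto simp: Hom_def)
  then have "short_exact C k e"
    using epi_is_cokernel[OF epi] cokernel_of_kernel unfolding short_exact_def by blast
  then have "is_cokernel (Rep Q C) (g_arr Q C i k) (g_arr Q C i e)"
    using exact unfolding exact_functor_def short_exact_def by blast
  then have g_epi: "epi_arr (Rep Q C) (g_arr Q C i e)"
    by (rule Rep.cokernel_epi)
  have ge: "g_arr Q C i e \<in> Hom (Rep Q C) (g_obj Q C i X) (g_obj Q C i Y)"
    using exact e unfolding exact_functor_def additive_functor_def by blast
  obtain \<phi> where \<phi>: "\<phi> \<in> Hom (Rep Q C) P (g_obj Q C i Y)" and \<phi>f: "proj Q C i Y i (i, []) \<cdot> comp_at \<phi> i = f"
    using g_obj_transpose[OF i Y PR f] .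
  obtain \<psi> where \<psi>: "\<psi> \<in> Hom (Rep Q C) P (g_obj Q C i X)" and "g_arr Q C i e \<cdot>\<^bsub>Rep Q C\<^esub> \<psi> = \<phi>"
    using Rep.projective_lift[OF P ge g_epi \<phi>] .
  then have ge\<psi>: "comp_at (g_arr Q C i e) i \<cdot> comp_at \<psi> i = comp_at \<phi> i"
    using i comp_at_Rep(1) by metis
  have gei: "comp_at (g_arr Q C i e) i \<in> Hom C (g_vert Q C i X i) (g_vert Q C i Y i)"
    and \<psi>i: "comp_at \<psi> i \<in> Hom C (at_vert P i) (g_vert Q C i X i)"
    using Rep_Hom_comp_at[OF ge i] Rep_Hom_comp_at[OF \<psi> i] i by (simp_all add: g_obj_at_vert)
  note t = trivial_path[OF i]
  note pX = proj_Hom[OF i i X t] and pY = proj_Hom[OF i i Y t]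
  \<comment> \<open>The projection at the trivial path is the counit: applied to
    \<open>g_i(e) \<psi> = \<phi>\<close> at \<open>i\<close>, it gives \<open>e\<close> after the
    transpose of \<psi> on one side and \<open>f\<close> on the other.\<close>
  have "e \<cdot> (proj Q C i X i (i, []) \<cdot> comp_at \<psi> i) = f"
    using Comp_assoc[OF \<psi>i pX e] g_arr_proj[OF i i e t] Comp_assoc[OF \<psi>i gei pY] ge\<psi> \<phi>f by simp
  then show "\<exists>h \<in> Hom C (at_vert P i) X. e \<cdot> h = f"
    using Comp_Hom[OF \<psi>i pX] by blast
qed

end

theorem proposition3p30:
  fixes Q :: "('v, 'a) quiver" and C :: "('o, 'm) cat" and \<kappa> :: "'k rel"
  assumes "quiver Q"
    and "Cinfinite \<kappa>" and "rccn Q \<le>o \<kappa>" and "ltccn Q \<le>o \<kappa>"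
    and "abelian_category C" and "AB3 \<kappa> C"
  shows
    \<comment> \<open>(a)\<close>
    "(\<forall>U. generating C U \<longrightarrow>
        (\<forall>F \<in> Obj (Rep Q C). \<exists>V P \<iota> e.
           (\<forall>i \<in> Supp Q C F. V i \<in> U) \<and>
           is_coproduct (Rep Q C) (Supp Q C F) (\<lambda>i. f_obj Q C i (V i)) P \<iota> \<and>
           e \<in> Hom (Rep Q C) P F \<and> epi_arr (Rep Q C) e) \<and>
        generating (Rep Q C) (Coprod_le (Rep Q C) |Vert Q| (f_star Q C U)))
     \<and> \<comment> \<open>(b)\<close>
     (enough_projectives C \<longrightarrow>
        enough_projectives (Rep Q C) \<and>
        Add_le (Rep Q C) |Vert Q| (f_star Q C (Proj C)) = Proj (Rep Q C))
     \<and> \<comment> \<open>(c)\<close>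
     Add_le (Rep Q C) |Vert Q| (f_star Q C (Proj C)) \<subseteq> Proj (Rep Q C)
     \<and> Proj (Rep Q C) \<subseteq> Add_le (Rep Q C) |Vert Q| (f_star Q C (Obj C))
     \<and> \<comment> \<open>(d)\<close>
     (\<forall>\<kappa>' :: 'l rel.
        Cinfinite \<kappa>' \<and> lccn Q \<le>o \<kappa>' \<and> AB3_star \<kappa>' C \<and>
        (\<forall>i \<in> Vert Q. exact_functor C (Rep Q C) (g_obj Q C i) (g_arr Q C i)) \<longrightarrow>
        Proj (Rep Q C) = Add_le (Rep Q C) |Vert Q| (f_star Q C (Proj C)))"
proof -
  interpret abelian_category C by fact
  interpret quiver_representations Q C
    by (intro quiver_representations.intro assms(1,5))
  have \<kappa>: "Card_order \<kappa>"
    using assms(2) by blast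
  interpret quiver_representations_coproducts Q C
  proof
    show "\<exists>P \<mu>. is_coproduct C (paths Q i j) (\<lambda>_. X) P \<mu>"
      if "i \<in> Vert Q" "j \<in> Vert Q" "X \<in> Obj C" for i j X
      using that by (intro AB3_ex_coproduct[OF assms(6) \<kappa>] card_paths_less_rccn[OF assms(3)])
    show "\<exists>P \<mu>. is_coproduct C K B P \<mu>"
      if "j \<in> Vert Q" "K \<subseteq> paths_to Q j" "\<And>\<rho>. \<rho> \<in> K \<Longrightarrow> B \<rho> \<in> Obj C" for j K B
    proof -
      \<comment> \<open>The strict bound on all paths ending at \<open>j\<close> passes to
        subsets.\<close>
      have "|K| <o \<kappa>"
        using ordLeq_ordLess_trans[OF card_of_mono1[OF that(2)] card_paths_to_less_ltccn[OF assms(4) that(1)]] .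
      then show ?thesis
        using that(3) by (rule AB3_ex_coproduct[OF assms(6) \<kappa>])
    qed
  qed
  have Proj_subset: "Proj C \<subseteq> Obj C"
    by (auto simp: Proj_def projective_def)
  have b: "enough_projectives (Rep Q C) \<and>
      Add_le (Rep Q C) |Vert Q| (f_star Q C (Proj C)) = Proj (Rep Q C)" if "enough_projectives C"
  proof -
    \<comment> \<open>Having enough projectives means that the projectives form a generating class,
      so the statements on generating classes apply to \<open>Proj C\<close>.\<close>
    have gen: "generating C (Proj C)"
      using that Proj_subset by (simp add: generating_def enough_projectives_def)
    have "enough_projectives (Rep Q C)"
      using generating_Rep[OF gen] Coprod_le_f_star_Proj unfolding generating_def enough_projectives_def
      by blast
    then show ?thesis
      using Add_le_f_star_Proj Proj_Rep_le_Add_le_generating[OF gen] by blast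
  qed
  \<comment> \<open>The class of all objects is generating by way of identities.\<close>
  have c: "Proj (Rep Q C) \<subseteq> Add_le (Rep Q C) |Vert Q| (f_star Q C (Obj C))"
    using Id_Hom epi_Id by (intro Proj_Rep_le_Add_le_generating) (auto simp: generating_def)
  have d: "Proj (Rep Q C) = Add_le (Rep Q C) |Vert Q| (f_star Q C (Proj C))"
    if "Cinfinite \<kappa>'" and "lccn Q \<le>o \<kappa>'" and "AB3_star \<kappa>' C"
      and exact: "\<forall>i \<in> Vert Q. exact_functor C (Rep Q C) (g_obj Q C i) (g_arr Q C i)" for \<kappa>' :: "'l rel"
  proof -
    have \<kappa>': "Card_order \<kappa>'"
      using that(1) by blast
    interpret quiver_representations_powers Q C
    proof
      show "\<exists>P \<pi>. is_product C (paths Q j i) (\<lambda>_. X) P \<pi>"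
        if "i \<in> Vert Q" "j \<in> Vert Q" "X \<in> Obj C" for i j X
        using that
        by (intro AB3_star_ex_product[OF \<open>AB3_star \<kappa>' C\<close> \<kappa>'] card_paths_less_lccn[OF \<open>lccn Q \<le>o \<kappa>'\<close>])
    qed
    have "Proj (Rep Q C) \<subseteq> Add_le (Rep Q C) |Vert Q| (f_star Q C (Proj C))"
    proof (rule Proj_Rep_le_Add_le)
      fix P
      assume P: "projective (Rep Q C) P"
      \<comment> \<open>The value of \<open>P\<close> at \<open>i\<close> covers itself by the
        identity; it is projective because g_i is exact.\<close>
      then have "at_vert P i \<in> Proj C \<and> Id C (at_vert P i) \<in> Hom C (at_vert P i) (at_vert P i)
          \<and> epi_arr C (Id C (at_vert P i))" if "i \<in> Supp Q C P" for i
        using that projective_at_vert[of i P] exact Proj_subset Id_Hom epi_Id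
        by (auto simp: Supp_def Proj_def)
      then show "\<exists>V u. \<forall>i \<in> Supp Q C P.
          V i \<in> Proj C \<and> u i \<in> Hom C (V i) (at_vert P i) \<and> epi_arr C (u i)"
        by (intro exI[of _ "at_vert P"] exI[of _ "\<lambda>i. Id C (at_vert P i)"]) blast
    qed
    then show ?thesis
      using Add_le_f_star_Proj by blast
  qed
  show ?thesis
  proof (intro conjI allI impI ballI, goal_cases)
    case (1 U F)
    then show ?case
      using generating_epi by simp
  next
    case (2 U)
    then show ?case
      by (rule generating_Rep)
  next
    case 3
    then show ?case
      using b by simp
  next
    case 4
    then show ?case
      using b by simp
  next
    case 5
    show ?case
      by (rule Add_le_f_star_Proj)
  next
    case 6
    show ?case
      by (rule c)
  next
    case (7 \<kappa>')
    then show ?case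
      by (elim conjE) (rule d, simp_all)
  qed
qed

end
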